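(* Let $G$ be a finitely presented group and let $H\unlhd G$ be a finitely generated normal subgroup. If the quotient $G/H$ is abelian with torsion-free rank at most two, then $H$ is invariantly finitely $L$-presented.
   Context: Endomorphisms act on the right, written $g\mapsto g^\sigma$. For an alphabet $\mathcal X$, $F(\mathcal X)$ is the free group over $\mathcal X$; $\langle A\rangle^F$ is the normal closure of $A$ in $F$. An $L$-presentation $\langle\mathcal X\mid\mathcal Q\mid\Phi\mid\mathcal R\rangle$ consists of an alphabet $\mathcal X$ (generators), subsets $\mathcal Q$ (fixed relations) and $\mathcal R$ (iterated relations) of $F=F(\mathcal X)$, and a subset $\Phi\subseteq\mathrm{End}(F)$ (substitutions). With $\Phi^*\subseteq\mathrm{End}(F)$ the monoid generated by $\Phi$, it defines the group $F/K$ where $K=\langle\mathcal Q\cup\bigcup_{\sigma\in\Phi^*}\mathcal R^\sigma\rangle^F$. It is finite if $\mathcal X,\mathcal Q,\Phi,\mathcal R$ are finite. It is invariant if each $\varphi\in\Phi$ induces an endomorphism of the group, i.e. $K^\varphi\subseteq K$. A group is invariantly finitely $L$-presented if it is isomorphic to the group defined by some invariant finite $L$-presentation. The (necessarily finitely generated) abelian group $G/H$ is isomorphic to $\mathbb Z^\ell\times T$ with $T$ finite; $\ell$ is its torsion-free rank. *)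

theory Defs
  imports "HOL-Algebra.Elementary_Groups" "HOL-Algebra.Product_Groups"
begin

section \<open>Free groups\<close>

text \<open>
  A letter \<open>(x, True)\<close> stands for the generator \<open>x\<close>, and \<open>(x, False)\<close> for its inverse.
  The elements of the free group are the reduced words, and the product of two of them is the
  reduced form of their concatenation.
\<close>

type_synonym 'x letter = "'x \<times> bool"
type_synonym 'x word = "'x letter list"

definition cancels :: "'x letter \<Rightarrow> 'x letter \<Rightarrow> bool" where
  "cancels a b \<longleftrightarrow> fst a = fst b \<and> snd a \<noteq> snd b"

definition reduced :: "'x word \<Rightarrow> bool" where
  "reduced w \<longleftrightarrow> successively (\<lambda>a b. \<not> cancels a b) w"

text \<open>Prepending a letter to a reduced word, with at most one cancellation.\<close>

fun red_cons :: "'x letter \<Rightarrow> 'x word \<Rightarrow> 'x word" where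
  "red_cons a [] = [a]"
| "red_cons a (b # w) = (if cancels a b then w else a # b # w)"

definition free_group :: "'x set \<Rightarrow> 'x word monoid" where
  "free_group X =
     \<lparr>carrier = {w. reduced w \<and> fst ` set w \<subseteq> X},
      monoid.mult = (\<lambda>u v. foldr red_cons u v),
      one = []\<rparr>"

lemma carrier_free_group: "carrier (free_group X) = {w. reduced w \<and> fst ` set w \<subseteq> X}"
  and mult_free_group: "u \<otimes>\<^bsub>free_group X\<^esub> v = foldr red_cons u v"
  and one_free_group: "\<one>\<^bsub>free_group X\<^esub> = []"
  by (simp_all add: free_group_def)

lemma reduced_Nil [simp]: "reduced []"
  by (simp add: reduced_def)

lemma reduced_Cons:
  "reduced (a # w) \<longleftrightarrow> reduced w \<and> (w = [] \<or> \<not> cancels a (hd w))"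
  by (cases w) (auto simp: reduced_def)

lemma reduced_red_cons: "reduced w \<Longrightarrow> reduced (red_cons a w)"
  by (cases w) (auto simp: reduced_Cons)

lemma set_red_cons: "set (red_cons a w) \<subseteq> insert a (set w)"
  by (cases w) auto

lemma red_cons_reduced: "reduced (a # w) \<Longrightarrow> red_cons a w = a # w"
  by (cases w) (auto simp: reduced_Cons)

lemma red_cons_cancels:
  assumes "reduced w" "cancels a b"
  shows "red_cons a (red_cons b w) = w"
proof (cases w)
  case (Cons c v)
  show ?thesis
  proof (cases "cancels b c")
    case True
    then have "c = a" using assms(2) by (cases a; cases b; cases c) (auto simp: cancels_def)
    then show ?thesis using Cons True assms(1) red_cons_reduced[of a v] by simp
  qed (use Cons assms(2) in simp)
qed (use assms(2) in simp)

lemma reduced_foldr_red_cons: "reduced v \<Longrightarrow> reduced (foldr red_cons u v)"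
  by (induction u) (auto intro: reduced_red_cons)

lemma set_foldr_red_cons: "set (foldr red_cons u v) \<subseteq> set u \<union> set v"
proof (induction u)
  case (Cons a u)
  then show ?case using set_red_cons[of a "foldr red_cons u v"] by auto
qed simp

lemma foldr_red_cons_reduced: "reduced u \<Longrightarrow> foldr red_cons u [] = u"
  by (induction u) (auto simp: reduced_Cons red_cons_reduced)

lemma foldr_red_cons_red_cons:
  assumes "reduced w"
  shows "foldr red_cons (red_cons a v) w = red_cons a (foldr red_cons v w)"
  using assms by (cases v) (auto simp: red_cons_cancels reduced_foldr_red_cons)

lemma foldr_red_cons_assoc:
  "reduced w \<Longrightarrow> foldr red_cons (foldr red_cons u v) w = foldr red_cons u (foldr red_cons v w)"
  by (induction u) (auto simp: foldr_red_cons_red_cons)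

definition inv_word :: "'x word \<Rightarrow> 'x word" where
  "inv_word w = rev (map (\<lambda>(x, e). (x, \<not> e)) w)"

lemma reduced_inv_word: "reduced w \<Longrightarrow> reduced (inv_word w)"
  unfolding reduced_def inv_word_def successively_rev successively_map
  by (erule successively_mono) (auto simp: cancels_def)

lemma fst_set_inv_word: "fst ` set (inv_word w) = fst ` set w"
  by (force simp: inv_word_def)

lemma foldr_red_cons_inv_word: "foldr red_cons (inv_word w) w = []"
proof (induction w)
  case (Cons a w)
  have "red_cons (fst a, \<not> snd a) (a # w) = w"
    by (simp add: cancels_def)
  then show ?case using Cons by (simp add: inv_word_def case_prod_unfold)
qed (simp add: inv_word_def)

lemma group_free_group: "group (free_group X)"
proof (rule groupI)
  fix u v assume "u \<in> carrier (free_group X)" "v \<in> carrier (free_group X)"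
  then show "u \<otimes>\<^bsub>free_group X\<^esub> v \<in> carrier (free_group X)"
    using set_foldr_red_cons[of u v]
    by (fastforce simp: carrier_free_group mult_free_group reduced_foldr_red_cons)
next
  fix u assume u: "u \<in> carrier (free_group X)"
  show "\<exists>v\<in>carrier (free_group X). v \<otimes>\<^bsub>free_group X\<^esub> u = \<one>\<^bsub>free_group X\<^esub>"
    by (rule bexI[of _ "inv_word u"])
      (use u in \<open>auto simp: carrier_free_group mult_free_group one_free_group
         foldr_red_cons_inv_word fst_set_inv_word reduced_inv_word simp del: image_subset_iff\<close>)
qed (auto simp: carrier_free_group mult_free_group one_free_group foldr_red_cons_assoc)

text \<open>The universal property.\<close>

definition eval_word :: "('a, 'b) monoid_scheme \<Rightarrow> ('x \<Rightarrow> 'a) \<Rightarrow> 'x word \<Rightarrow> 'a" where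
  "eval_word G f w =
     foldr (\<lambda>(x, e) g. (if e then f x else inv\<^bsub>G\<^esub> (f x)) \<otimes>\<^bsub>G\<^esub> g) w \<one>\<^bsub>G\<^esub>"

lemma eval_word_simps:
  "eval_word G f [] = \<one>\<^bsub>G\<^esub>"
  "eval_word G f (a # w) =
     (if snd a then f (fst a) else inv\<^bsub>G\<^esub> (f (fst a))) \<otimes>\<^bsub>G\<^esub> eval_word G f w"
  by (simp_all add: eval_word_def case_prod_unfold)

context group
begin

lemma eval_word_closed:
  "f \<in> X \<rightarrow> carrier G \<Longrightarrow> fst ` set w \<subseteq> X \<Longrightarrow> eval_word G f w \<in> carrier G"
  by (induction w) (auto simp: eval_word_simps)

lemma eval_word_red_cons:
  assumes "f \<in> X \<rightarrow> carrier G" "fst ` set (a # w) \<subseteq> X"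
  shows "eval_word G f (red_cons a w) = eval_word G f (a # w)"
proof (cases w)
  case (Cons b v)
  have "eval_word G f v \<in> carrier G" "f (fst a) \<in> carrier G"
    using assms Cons eval_word_closed[of f X v] by auto
  then show ?thesis
    using Cons by (auto simp: eval_word_simps cancels_def inv_solve_left m_assoc[symmetric])
qed (simp add: eval_word_simps)

lemma eval_word_mult:
  assumes "f \<in> X \<rightarrow> carrier G" "fst ` set u \<subseteq> X" "fst ` set v \<subseteq> X"
  shows "eval_word G f (foldr red_cons u v) = eval_word G f u \<otimes> eval_word G f v"
  using assms(2)
proof (induction u)
  case Nil
  then show ?case using assms eval_word_closed[of f X v] by (simp add: eval_word_simps)
next
  case (Cons a u)
  have "fst ` set (a # foldr red_cons u v) \<subseteq> X"
    using Cons.prems assms(3) set_foldr_red_cons[of u v] by fastforce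
  moreover have "f (fst a) \<in> carrier G" "eval_word G f u \<in> carrier G" "eval_word G f v \<in> carrier G"
    using assms Cons.prems eval_word_closed[of f X] by auto
  ultimately show ?case
    using Cons eval_word_red_cons[OF assms(1), of a "foldr red_cons u v"]
    by (auto simp: eval_word_simps m_assoc)
qed

lemma free_group_universal:
  assumes "f \<in> X \<rightarrow> carrier G"
  shows "eval_word G f \<in> hom (free_group X) G"
    and "x \<in> X \<Longrightarrow> eval_word G f [(x, True)] = f x"
  using assms eval_word_closed[OF assms] eval_word_mult[OF assms]
  by (auto simp: hom_def carrier_free_group mult_free_group eval_word_simps Pi_iff)

end

section \<open>Finitely generated and finitely presented groups\<close>

definition normal_closure :: "('a, 'b) monoid_scheme \<Rightarrow> 'a set \<Rightarrow> 'a set" where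
  "normal_closure G A = \<Inter> {N. N \<lhd> G \<and> A \<subseteq> N}"

lemma (in group) normal_normal_closure:
  assumes "A \<subseteq> carrier G"
  shows "normal_closure G A \<lhd> G"
proof -
  have "carrier G \<lhd> G"
    by (simp add: normal_inv_iff subgroup_self)
  then have "subgroup (normal_closure G A) G"
    unfolding normal_closure_def
    by (intro subgroups_Inter) (use assms in \<open>auto dest: normal_imp_subgroup\<close>)
  then show ?thesis
    by (auto simp: normal_inv_iff normal_closure_def)
qed

definition finitely_generated :: "('a, 'b) monoid_scheme \<Rightarrow> bool" where
  "finitely_generated G \<longleftrightarrow>
     group G \<and> (\<exists>S. finite S \<and> S \<subseteq> carrier G \<and> generate G S = carrier G)"

text \<open>Every finite alphabet can be relabelled by natural numbers, so it suffices to consider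
  alphabets \<open>X :: nat set\<close>; the same holds for the \<open>L\<close>-presentations below.\<close>

definition finitely_presented :: "('a, 'b) monoid_scheme \<Rightarrow> bool" where
  "finitely_presented G \<longleftrightarrow>
     group G \<and>
     (\<exists>(X :: nat set) R. finite X \<and> finite R \<and> R \<subseteq> carrier (free_group X) \<and>
        G \<cong> free_group X Mod normal_closure (free_group X) R)"

section \<open>\<open>L\<close>-presentations\<close>

record 'x L_pres =
  generators :: "'x set"
  fixed_relations :: "'x word set"
  substitutions :: "('x word \<Rightarrow> 'x word) set"
  iterated_relations :: "'x word set"

abbreviation L_free :: "'x L_pres \<Rightarrow> 'x word monoid" where
  "L_free P \<equiv> free_group (generators P)"

definition L_presentation :: "'x L_pres \<Rightarrow> bool" where
  "L_presentation P \<longleftrightarrow>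
     fixed_relations P \<subseteq> carrier (L_free P) \<and>
     substitutions P \<subseteq> hom (L_free P) (L_free P) \<and>
     iterated_relations P \<subseteq> carrier (L_free P)"

text \<open>The monoid \<open>\<Phi>\<^sup>*\<close> under composition; as a set it does not depend on whether
  endomorphisms are written on the left or on the right.\<close>

inductive_set generated_monoid :: "('a \<Rightarrow> 'a) set \<Rightarrow> ('a \<Rightarrow> 'a) set"
  for \<Phi> :: "('a \<Rightarrow> 'a) set" where
  id: "id \<in> generated_monoid \<Phi>"
| incl: "\<phi> \<in> \<Phi> \<Longrightarrow> \<phi> \<in> generated_monoid \<Phi>"
| comp: "\<sigma> \<in> generated_monoid \<Phi> \<Longrightarrow> \<tau> \<in> generated_monoid \<Phi> \<Longrightarrow>
           \<sigma> \<circ> \<tau> \<in> generated_monoid \<Phi>"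

definition L_kernel :: "'x L_pres \<Rightarrow> 'x word set" where
  "L_kernel P = normal_closure (L_free P)
     (fixed_relations P \<union>
      (\<Union>\<sigma>\<in>generated_monoid (substitutions P). \<sigma> ` iterated_relations P))"

definition L_group :: "'x L_pres \<Rightarrow> 'x word set monoid" where
  "L_group P = L_free P Mod L_kernel P"

definition finite_L_pres :: "'x L_pres \<Rightarrow> bool" where
  "finite_L_pres P \<longleftrightarrow>
     finite (generators P) \<and> finite (fixed_relations P) \<and>
     finite (substitutions P) \<and> finite (iterated_relations P)"

definition invariant_L_pres :: "'x L_pres \<Rightarrow> bool" where
  "invariant_L_pres P \<longleftrightarrow> (\<forall>\<phi>\<in>substitutions P. \<phi> ` L_kernel P \<subseteq> L_kernel P)"

definition invariantly_finitely_L_presented :: "('a, 'b) monoid_scheme \<Rightarrow> bool" where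
  "invariantly_finitely_L_presented G \<longleftrightarrow>
     group G \<and>
     (\<exists>P :: nat L_pres. L_presentation P \<and> finite_L_pres P \<and> invariant_L_pres P \<and> G \<cong> L_group P)"

section \<open>Torsion-free rank\<close>

text \<open>\<open>A \<cong> \<int>\<^sup>\<ell> \<times> T\<close> with \<open>T\<close> finite. Every finite group is isomorphic to one whose elements
  are natural numbers, so the type of \<open>T\<close> is no restriction.\<close>

definition has_torsion_free_rank :: "('a, 'b) monoid_scheme \<Rightarrow> nat \<Rightarrow> bool" where
  "has_torsion_free_rank A l \<longleftrightarrow>
     comm_group A \<and>
     (\<exists>T :: nat monoid. comm_group T \<and> finite (carrier T) \<and>
        A \<cong> product_group {..<l} (\<lambda>_. integer_group) \<times>\<times> T)"

end

theory Submission
  imports Defs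
begin

text \<open>
  The subgroup \<open>H\<close> is presented as a group with operators, the operators being lifts to a free group of
  conjugation by elements of \<open>G\<close>.  Fix a finite set \<open>S\<close> that generates \<open>G\<close> and is closed under
  inversion.  Call a subgroup \<open>N\<close> operator-presented if some finitely generated free group \<open>F\<close> maps onto
  \<open>N\<close>, each \<open>g \<in> S\<close> has an endomorphism of \<open>F\<close> lifting conjugation by \<open>g\<close>, and the kernel of
  \<open>F \<rightarrow> N\<close> is the least normal subgroup that contains some finite set \<open>R\<close> and is invariant under these
  endomorphisms (\<open>op_presented\<close>).  This is an \<open>L\<close>-presentation without fixed relations, whose
  iterated relations are \<open>R\<close>; such a presentation is automatically invariant
  (\<open>op_presented_imp_L_presented\<close>).

  Since \<open>G\<close> is finitely presented, \<open>G\<close> itself is operator-presented for any choice of lifts.  Let \<open>S\<close>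
  consist of \<open>t\<^sub>1, \<dots>, t\<^sub>k\<close> and their inverses.  As \<open>G/H\<close> is abelian, every subgroup between \<open>H\<close> and
  \<open>G\<close> is normal, and \<open>H, \<langle>H, t\<^sub>1\<rangle>, \<langle>H, t\<^sub>1, t\<^sub>2\<rangle>, \<dots>, G\<close> is a chain of finitely
  generated normal subgroups with cyclic quotients, on which \<open>G\<close> acts trivially.  So it suffices to
  descend one cyclic step, from \<open>N = \<langle>M, t\<rangle>\<close> to \<open>M\<close> (\<open>op_presented_descend\<close>).

  For this step let \<open>F\<close> be a free group mapping onto \<open>M\<close>, with lifts \<open>\<phi>\<^sub>g\<close> of the conjugations.  For
  \<open>g \<in> S\<close> one has \<open>g t g\<^sup>-\<^sup>1 = m\<^sub>g t\<close> with \<open>m\<^sub>g \<in> M\<close>.  Finitely many relations of \<open>M\<close> say that \<open>\<phi>\<^sub>t\<close> and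
  its counterpart for the inverse of \<open>t\<close> are mutually inverse, and that \<open>\<phi>\<^sub>g\<close> is compatible with
  \<open>t \<mapsto> m\<^sub>g t\<close>.  Imposing them, together with their images under the operators, turns \<open>F\<close> into a group \<open>B\<close>
  that still maps onto \<open>M\<close>, and the operators extend to the semidirect product \<open>E\<close> of \<open>B\<close> with the
  infinite cyclic group \<open>\<langle>t\<rangle>\<close>, which maps onto \<open>N\<close>.

  The crucial point is that finiteness of the kernel does not depend on the presentation: because \<open>N\<close> is
  operator-presented, the kernel of \<^emph>\<open>every\<close> equivariant map from a finitely generated group with
  operators onto \<open>N\<close> is finitely generated as a normal operator subgroup (\<open>op_presented_transfer\<close>).  This
  applies to \<open>E\<close>.  The kernel of \<open>E \<rightarrow> N\<close> differs from that of \<open>B \<rightarrow> M\<close> only by the powers of one element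
  \<open>c = h\<^sup>-\<^sup>1 t\<^sup>n\<close>, where \<open>\<langle>t\<rangle> \<inter> M\<close> is generated by \<open>t\<^sup>n\<close>; as \<open>c\<close> becomes central and
  operator-invariant after imposing finitely many further relations in \<open>B\<close>, the kernel of \<open>B \<rightarrow> M\<close> is
  finitely generated as a normal operator subgroup too (\<open>fg_op_normal_descend\<close>), and hence so is that of
  \<open>F \<rightarrow> M\<close> (\<open>fg_op_normal_tower\<close>).
\<close>

section \<open>Homomorphisms and normal subgroups\<close>

lemma (in group) inv_mult_cancel:
  assumes "x \<in> carrier G" "y \<in> carrier G"
  shows "x \<otimes> (inv x \<otimes> y) = y" "inv x \<otimes> (x \<otimes> y) = y"
  using assms by (simp_all add: m_assoc[symmetric])

lemma group_homI: "group A \<Longrightarrow> group B \<Longrightarrow> f \<in> hom A B \<Longrightarrow> group_hom A B f"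
  by (simp add: group_hom_def group_hom_axioms_def)

lemma group_hom_comp:
  assumes "group_hom A B f" "group_hom B C g"
  shows "group_hom A C (\<lambda>x. g (f x))"
proof -
  interpret f: group_hom A B f by fact
  interpret g: group_hom B C g by fact
  show ?thesis by (intro group_homI homI) auto
qed

lemma equalizer_subgroup:
  assumes "group_hom A B f" "group_hom A B g"
  shows "subgroup {x \<in> carrier A. f x = g x} A"
proof -
  interpret f: group_hom A B f by fact
  interpret g: group_hom A B g by fact
  show ?thesis by (rule f.G.subgroupI) auto
qed

lemma group_hom_eq_on_generators:
  assumes "group_hom A B f" "group_hom A B g" "generate A S = carrier A"
    and "\<And>s. s \<in> S \<Longrightarrow> f s = g s" "x \<in> carrier A"
  shows "f x = g x"
proof -
  interpret f: group_hom A B f by fact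
  have "S \<subseteq> carrier A" using assms(3) by (auto intro: generate.incl)
  then have "generate A S \<subseteq> {x \<in> carrier A. f x = g x}"
    by (intro f.G.generate_subgroup_incl equalizer_subgroup[OF assms(1,2)]) (use assms(4) in auto)
  then show ?thesis using assms by auto
qed

lemma (in normal) rcos_eq_iff:
  assumes "x \<in> carrier G" "y \<in> carrier G"
  shows "H #> x = H #> y \<longleftrightarrow> x \<otimes> inv y \<in> H"
  using assms by (metis is_group rcos_module rcos_self repr_independence is_subgroup)

lemma group_hom_factor:
  assumes L: "L \<lhd> F" and f: "group_hom F C f" and k: "L \<subseteq> kernel F C f"
  obtains f' where "group_hom (F Mod L) C f'" "\<And>w. w \<in> carrier F \<Longrightarrow> f' (L #>\<^bsub>F\<^esub> w) = f w"
proof -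
  interpret f: group_hom F C f by (rule f)
  obtain f' where "f' \<in> hom (F Mod L) C" "\<And>w. w \<in> carrier F \<Longrightarrow> f' (L #>\<^bsub>F\<^esub> w) = f w"
    using f.FactGroup_universal_kernel[OF L k] by metis
  then show ?thesis
    using that group_homI[OF normal.factorgroup_is_group[OF L] f.H.is_group] by blast
qed

lemma normal_vimage:
  assumes "group_hom A B f" "N \<lhd> B"
  shows "{x \<in> carrier A. f x \<in> N} \<lhd> A"
proof -
  interpret f: group_hom A B f by fact
  interpret N: normal N B by fact
  show ?thesis
    unfolding f.G.normal_inv_iff by (auto intro!: f.G.subgroupI N.inv_op_closed2)
qed

lemma normal_image:
  assumes "group_hom A B f" "N \<lhd> A" "f ` carrier A = carrier B"
  shows "f ` N \<lhd> B"
proof -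
  interpret f: group_hom A B f by fact
  interpret N: normal N A by fact
  show ?thesis
    unfolding f.H.normal_inv_iff
  proof (intro conjI ballI)
    show "subgroup (f ` N) B" by (rule f.subgroup_img_is_subgroup) (rule N.subgroup_axioms)
    fix y h assume "y \<in> carrier B" "h \<in> f ` N"
    then obtain x n where x: "x \<in> carrier A" "y = f x" "n \<in> N" "h = f n"
      using assms(3) by blast
    then have "y \<otimes>\<^bsub>B\<^esub> h \<otimes>\<^bsub>B\<^esub> inv\<^bsub>B\<^esub> y = f (x \<otimes>\<^bsub>A\<^esub> n \<otimes>\<^bsub>A\<^esub> inv\<^bsub>A\<^esub> x)"
      by simp
    then show "y \<otimes>\<^bsub>B\<^esub> h \<otimes>\<^bsub>B\<^esub> inv\<^bsub>B\<^esub> y \<in> f ` N"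
      using N.inv_op_closed2[OF x(1,3)] by (simp only: imageI)
  qed
qed

text \<open>
  The case \<open>n = 0\<close> is the one in which no power of \<open>t\<close> with nonzero exponent lies in \<open>M\<close>; it
  lets infinite and finite cyclic quotients be treated alike.
\<close>

lemma (in group) exponents_into_subgroup:
  assumes "subgroup M G" "t \<in> carrier G"
  obtains n :: int where "\<And>i :: int. t [^] i \<in> M \<longleftrightarrow> n dvd i"
proof -
  interpret M: subgroup M G by fact
  have mult: "t [^] (i * k) \<in> M" if "t [^] i \<in> M" for i k :: int
    using subgroup_int_pow_closed[OF assms(1) that] assms(2) by (simp add: int_pow_pow)
  have diff: "t [^] (i - j) \<in> M" if "t [^] i \<in> M" "t [^] j \<in> M" for i j :: int
    using that assms(2) by (simp add: int_pow_diff)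
  show ?thesis
  proof (cases "\<exists>n>0. t [^] int n \<in> M")
    case True
    define n where "n = (LEAST n. 0 < n \<and> t [^] int n \<in> M)"
    have n: "0 < n" "t [^] int n \<in> M"
      using LeastI_ex[OF True] by (auto simp: n_def)
    have min: "n \<le> k" if "0 < k" "t [^] int k \<in> M" for k
      unfolding n_def by (rule Least_le) (use that in auto)
    have "int n dvd i" if "t [^] i \<in> M" for i
    proof (rule ccontr)
      assume "\<not> int n dvd i"
      then have r: "0 < i mod int n" "i mod int n < int n"
        using n(1) pos_mod_sign[of "int n" i] pos_mod_bound[of "int n" i]
        unfolding dvd_eq_mod_eq_0 by linarith+
      have "t [^] (i - int n * (i div int n)) \<in> M"
        by (rule diff[OF that mult[OF n(2)]])
      then have "t [^] (i mod int n) \<in> M" by (simp add: minus_mult_div_eq_mod)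
      then show False using min[of "nat (i mod int n)"] r by auto
    qed
    moreover have "t [^] i \<in> M" if "int n dvd i" for i
      using that mult[OF n(2)] by (auto simp: dvd_def)
    ultimately show ?thesis using that by blast
  next
    case False
    have "i = 0" if "t [^] i \<in> M" for i :: int
    proof (rule ccontr)
      assume "i \<noteq> 0"
      moreover have "t [^] (- i) \<in> M" using mult[OF that, of "- 1"] by simp
      ultimately show False using False that
        by (cases "0 < i") (auto dest!: spec[of _ "nat \<bar>i\<bar>"])
    qed
    then have "t [^] i \<in> M \<longleftrightarrow> 0 dvd i" for i :: int
      by (cases "i = 0") auto
    then show ?thesis using that by blast
  qed
qed

lemma commutators_in_normal:
  assumes "H \<lhd> G" "comm_group (G Mod H)" "g \<in> carrier G" "x \<in> carrier G"
  shows "g \<otimes>\<^bsub>G\<^esub> x \<otimes>\<^bsub>G\<^esub> inv\<^bsub>G\<^esub> g \<otimes>\<^bsub>G\<^esub> inv\<^bsub>G\<^esub> x \<in> H"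
proof -
  interpret H: normal H G by fact
  interpret Q: comm_group "G Mod H" by fact
  have q: "H #>\<^bsub>G\<^esub> y \<in> carrier (G Mod H)" if "y \<in> carrier G" for y
    using that by (auto simp: carrier_FactGroup)
  have "H #>\<^bsub>G\<^esub> (g \<otimes>\<^bsub>G\<^esub> x) = H #>\<^bsub>G\<^esub> (x \<otimes>\<^bsub>G\<^esub> g)"
    using Q.m_comm[OF q q, OF assms(3,4)] assms(3,4) by (simp add: H.rcos_sum)
  then show ?thesis
    using assms(3,4) by (subst (asm) H.rcos_eq_iff) (auto simp: H.inv_mult_group H.m_assoc)
qed

lemma normal_if_commutators:
  assumes "group G" "subgroup M G"
    and comm: "\<And>g x. g \<in> carrier G \<Longrightarrow> x \<in> carrier G \<Longrightarrow>
      g \<otimes>\<^bsub>G\<^esub> x \<otimes>\<^bsub>G\<^esub> inv\<^bsub>G\<^esub> g \<otimes>\<^bsub>G\<^esub> inv\<^bsub>G\<^esub> x \<in> M"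
  shows "M \<lhd> G"
proof -
  interpret group G by fact
  interpret M: subgroup M G by fact
  show ?thesis
    unfolding normal_inv_iff
  proof (intro conjI ballI assms(2))
    fix g x assume gx: "g \<in> carrier G" "x \<in> M"
    then have "g \<otimes>\<^bsub>G\<^esub> x \<otimes>\<^bsub>G\<^esub> inv\<^bsub>G\<^esub> g \<otimes>\<^bsub>G\<^esub> inv\<^bsub>G\<^esub> x \<otimes>\<^bsub>G\<^esub> x \<in> M"
      using comm[of g x] by auto
    then show "g \<otimes>\<^bsub>G\<^esub> x \<otimes>\<^bsub>G\<^esub> inv\<^bsub>G\<^esub> g \<in> M" using gx by (simp add: m_assoc)
  qed
qed

text \<open>
  When \<open>M\<close> is normal, products of elements of \<open>M\<close> and powers of \<open>t\<close> can be collected with the power on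
  the right.
\<close>

lemma generate_insert_normal:
  assumes M: "M \<lhd> G" "generate G A = M" "A \<subseteq> carrier G" and t: "t \<in> carrier G"
  shows "generate G (insert t A) = {x \<otimes>\<^bsub>G\<^esub> t [^]\<^bsub>G\<^esub> (i :: int) | x i. x \<in> M}" (is "_ = ?N")
proof
  interpret M: normal M G by (rule M)
  interpret I: subgroup "generate G (insert t A)" G
    by (rule M.generate_is_subgroup) (use M(3) t in auto)
  note M_closed = subgroup.one_closed[OF M.subgroup_axioms] subgroup.m_closed[OF M.subgroup_axioms]
    subgroup.m_inv_closed[OF M.subgroup_axioms]
  have NC: "?N \<subseteq> carrier G" using t by auto
  have conj: "t [^]\<^bsub>G\<^esub> (i :: int) \<otimes>\<^bsub>G\<^esub> x \<otimes>\<^bsub>G\<^esub> inv\<^bsub>G\<^esub> (t [^]\<^bsub>G\<^esub> i) \<in> M" if "x \<in> M" for x i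
    using that t by (intro M.inv_op_closed2) auto
  have "subgroup ?N G"
  proof (rule M.subgroupI[OF NC])
    have "\<one>\<^bsub>G\<^esub> \<otimes>\<^bsub>G\<^esub> t [^]\<^bsub>G\<^esub> (0 :: int) \<in> ?N" using M_closed(1) by blast
    then show "?N \<noteq> {}" by (metis empty_iff)
  next
    fix a assume "a \<in> ?N"
    then obtain x and i :: int where a: "a = x \<otimes>\<^bsub>G\<^esub> t [^]\<^bsub>G\<^esub> i" "x \<in> M" by blast
    have "inv\<^bsub>G\<^esub> a = t [^]\<^bsub>G\<^esub> (- i) \<otimes>\<^bsub>G\<^esub> inv\<^bsub>G\<^esub> x \<otimes>\<^bsub>G\<^esub> inv\<^bsub>G\<^esub> (t [^]\<^bsub>G\<^esub> (- i)) \<otimes>\<^bsub>G\<^esub> t [^]\<^bsub>G\<^esub> (- i)"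
      using a M.int_pow_closed[OF t, of i] M.mem_carrier[OF a(2)] unfolding M.int_pow_neg[OF t]
      by (simp add: M.inv_mult_group M.m_assoc)
    then show "inv\<^bsub>G\<^esub> a \<in> ?N" using conj[of "inv\<^bsub>G\<^esub> x" "- i"] M_closed(3)[OF a(2)] by blast
  next
    fix a b assume "a \<in> ?N" "b \<in> ?N"
    then obtain x y and i j :: int where a: "a = x \<otimes>\<^bsub>G\<^esub> t [^]\<^bsub>G\<^esub> i" "x \<in> M"
      "b = y \<otimes>\<^bsub>G\<^esub> t [^]\<^bsub>G\<^esub> j" "y \<in> M" by blast
    have "a \<otimes>\<^bsub>G\<^esub> b = x \<otimes>\<^bsub>G\<^esub> (t [^]\<^bsub>G\<^esub> i \<otimes>\<^bsub>G\<^esub> y \<otimes>\<^bsub>G\<^esub> inv\<^bsub>G\<^esub> (t [^]\<^bsub>G\<^esub> i)) \<otimes>\<^bsub>G\<^esub> t [^]\<^bsub>G\<^esub> (i + j)"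
      unfolding a(1,3) M.int_pow_mult[OF t]
      by (simp only: M.m_assoc M.inv_mult_cancel M.int_pow_closed M.m_closed M.inv_closed t
          M.mem_carrier[OF a(2)] M.mem_carrier[OF a(4)])
    then show "a \<otimes>\<^bsub>G\<^esub> b \<in> ?N" using M_closed(2)[OF a(2) conj[OF a(4), of i]] by blast
  qed
  moreover have "insert t A \<subseteq> ?N"
  proof -
    have "t = \<one>\<^bsub>G\<^esub> \<otimes>\<^bsub>G\<^esub> t [^]\<^bsub>G\<^esub> (1 :: int)" using t by simp
    moreover have "a = a \<otimes>\<^bsub>G\<^esub> t [^]\<^bsub>G\<^esub> (0 :: int)" "a \<in> M" if "a \<in> A" for a
      using that M(2,3) by (auto intro: generate.incl)
    ultimately show ?thesis using M_closed(1) by blast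
  qed
  ultimately show "generate G (insert t A) \<subseteq> ?N"
    by (intro M.generate_subgroup_incl)
  have "M \<subseteq> generate G (insert t A)"
    unfolding M(2)[symmetric] by (rule M.mono_generate) auto
  moreover have "t [^]\<^bsub>G\<^esub> (i :: int) \<in> generate G (insert t A)" for i
    by (rule M.subgroup_int_pow_closed[OF I.subgroup_axioms]) (auto intro: generate.incl)
  ultimately show "?N \<subseteq> generate G (insert t A)" by auto
qed

section \<open>Free groups\<close>

lemma free_group_generated:
  "generate (free_group X) ((\<lambda>x. [(x, True)]) ` X) = carrier (free_group X)" (is "generate ?F ?S = _")
proof
  interpret group "?F" by (rule group_free_group)
  have S: "?S \<subseteq> carrier ?F" by (auto simp: carrier_free_group reduced_def)
  then show "generate ?F ?S \<subseteq> carrier ?F" by (rule generate_incl)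
  interpret Q: subgroup "generate ?F ?S" ?F by (rule generate_is_subgroup[OF S])
  show "carrier ?F \<subseteq> generate ?F ?S"
  proof
    fix w assume "w \<in> carrier ?F"
    then show "w \<in> generate ?F ?S"
    proof (induction w)
      case Nil
      then show ?case using Q.one_closed by (simp add: one_free_group)
    next
      case (Cons a w)
      then have w: "w \<in> generate ?F ?S" and a: "fst a \<in> X" "reduced (a # w)"
        by (auto simp: carrier_free_group reduced_Cons)
      have T: "[(fst a, True)] \<in> generate ?F ?S" using a by (auto intro: generate.incl)
      have "inv\<^bsub>?F\<^esub> [(fst a, True)] = [(fst a, False)]"
        by (rule inv_equality)
          (use a in \<open>auto simp: carrier_free_group reduced_def mult_free_group one_free_group cancels_def\<close>)
      then have "[a] \<in> generate ?F ?S" using T Q.m_inv_closed[OF T]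
        by (cases a; cases "snd a") auto
      then have "[a] \<otimes>\<^bsub>?F\<^esub> w \<in> generate ?F ?S" using w by (rule Q.m_closed)
      then show ?case using a by (simp add: mult_free_group red_cons_reduced)
    qed
  qed
qed

lemma free_group_hom_eq:
  assumes "group_hom (free_group X) B f" "group_hom (free_group X) B g"
    and "\<And>x. x \<in> X \<Longrightarrow> f [(x, True)] = g [(x, True)]" "w \<in> carrier (free_group X)"
  shows "f w = g w"
  using group_hom_eq_on_generators[OF assms(1,2) free_group_generated] assms(3,4) by auto

text \<open>
  Free groups are projective: it is enough to choose preimages of the values on the letters.
\<close>

lemma free_group_lift:
  assumes "group_hom E B \<theta>" "group_hom (free_group X) B \<pi>"
    and "\<pi> ` carrier (free_group X) \<subseteq> \<theta> ` carrier E"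
  obtains \<pi>' where "group_hom (free_group X) E \<pi>'"
    "\<And>w. w \<in> carrier (free_group X) \<Longrightarrow> \<theta> (\<pi>' w) = \<pi> w"
proof -
  interpret \<theta>: group_hom E B \<theta> by fact
  have "\<exists>e\<in>carrier E. \<theta> e = \<pi> [(x, True)]" if "x \<in> X" for x
  proof -
    have "[(x, True)] \<in> carrier (free_group X)"
      using that by (auto simp: carrier_free_group reduced_def)
    then have "\<pi> [(x, True)] \<in> \<theta> ` carrier E" using assms(3) by blast
    then show ?thesis by (metis imageE)
  qed
  then obtain f where f: "\<And>x. x \<in> X \<Longrightarrow> f x \<in> carrier E \<and> \<theta> (f x) = \<pi> [(x, True)]" by metis
  then have fX: "f \<in> X \<rightarrow> carrier E" by auto
  have hom: "group_hom (free_group X) E (eval_word E f)"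
    by (intro group_homI group_free_group \<theta>.G.is_group \<theta>.G.free_group_universal fX)
  show ?thesis
  proof
    show "group_hom (free_group X) E (eval_word E f)" by (rule hom)
    fix w assume "w \<in> carrier (free_group X)"
    then show "\<theta> (eval_word E f w) = \<pi> w"
      by (rule free_group_hom_eq[OF group_hom_comp[OF hom assms(1)] assms(2), rotated])
        (simp add: \<theta>.G.free_group_universal(2)[OF fX] f)
  qed
qed

lemma free_group_onto:
  assumes "group G" "finite A" "A \<subseteq> carrier G"
  obtains X :: "nat set" and \<pi> where "finite X" "group_hom (free_group X) G \<pi>"
    "\<pi> ` carrier (free_group X) = generate G A"
proof -
  interpret group G by fact
  obtain f where f: "bij_betw f {..<card A} A"
    using ex_bij_betw_nat_finite[OF assms(2)] by (auto simp: atLeast0LessThan)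
  let ?X = "{..<card A}"
  have fX: "f \<in> ?X \<rightarrow> carrier G" using f assms(3) by (auto simp: bij_betw_def)
  have hom: "group_hom (free_group ?X) G (eval_word G f)"
    by (intro group_homI group_free_group is_group free_group_universal fX)
  interpret \<pi>: group_hom "free_group ?X" G "eval_word G f" by (rule hom)
  have "eval_word G f ` generate (free_group ?X) ((\<lambda>x. [(x, True)]) ` ?X) =
    generate G (eval_word G f ` (\<lambda>x. [(x, True)]) ` ?X)"
    by (rule \<pi>.generate_img[symmetric]) (auto simp: carrier_free_group reduced_def)
  also have "eval_word G f ` (\<lambda>x. [(x, True)]) ` ?X = f ` ?X"
    unfolding image_image using free_group_universal(2)[OF fX] by (intro image_cong) auto
  finally show ?thesis
    using f that[OF _ hom] by (simp add: free_group_generated bij_betw_def)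
qed

section \<open>Normal subgroups that are finitely generated under operators\<close>

text \<open>
  A family \<open>\<gamma>\<close> of endomorphisms indexed by a set \<open>S\<close> makes \<open>E\<close> a group with operators.  Indexing by the
  same \<open>S\<close> (later a set of group elements acting by conjugation) makes operators on different groups
  comparable.
\<close>

definition op_normal :: "('e, 'm) monoid_scheme \<Rightarrow> 's set \<Rightarrow> ('s \<Rightarrow> 'e \<Rightarrow> 'e) \<Rightarrow> 'e set \<Rightarrow> bool" where
  "op_normal E S \<gamma> D \<longleftrightarrow> D \<lhd> E \<and> (\<forall>g\<in>S. \<gamma> g ` D \<subseteq> D)"

text \<open>
  Finite generation of \<open>K\<close> as a normal operator subgroup.  Stated by testing against all normal operator
  subgroups \<open>D\<close>, it is used without ever writing down products of conjugates of images of generators.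
\<close>

definition fg_op_normal :: "('e, 'm) monoid_scheme \<Rightarrow> 's set \<Rightarrow> ('s \<Rightarrow> 'e \<Rightarrow> 'e) \<Rightarrow> 'e set \<Rightarrow> bool" where
  "fg_op_normal E S \<gamma> K \<longleftrightarrow>
     (\<exists>W. finite W \<and> W \<subseteq> K \<and> (\<forall>D. op_normal E S \<gamma> D \<longrightarrow> W \<subseteq> D \<longrightarrow> K \<subseteq> D))"

lemma op_normal_closure:
  assumes "group E" "\<And>g. g \<in> S \<Longrightarrow> group_hom E E (\<gamma> g)" "W \<subseteq> carrier E"
  obtains L where "op_normal E S \<gamma> L" "W \<subseteq> L"
    "\<And>D. op_normal E S \<gamma> D \<Longrightarrow> W \<subseteq> D \<Longrightarrow> L \<subseteq> D"
proof
  interpret group E by fact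
  define L where "L = \<Inter> {D. op_normal E S \<gamma> D \<and> W \<subseteq> D}"
  have "carrier E \<lhd> E"
    by (simp add: normal_inv_iff subgroup_self)
  then have top: "op_normal E S \<gamma> (carrier E)"
    unfolding op_normal_def by (auto simp: image_subset_iff dest: assms(2)[THEN group_hom.hom_closed])
  then have "subgroup L E"
    unfolding L_def
    by (intro subgroups_Inter) (use assms(3) in \<open>auto simp: op_normal_def dest: normal_imp_subgroup\<close>)
  then have "L \<lhd> E"
    unfolding normal_inv_iff by (auto simp: op_normal_def L_def normal_inv_iff)
  then show "op_normal E S \<gamma> L"
    unfolding op_normal_def L_def by blast
  show "W \<subseteq> L" "\<And>D. op_normal E S \<gamma> D \<Longrightarrow> W \<subseteq> D \<Longrightarrow> L \<subseteq> D"
    by (auto simp: L_def)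
qed

text \<open>
  Generators for the kernel of \<open>q\<close> together with preimages of generators for the image of \<open>K\<close> generate
  \<open>K\<close>: a normal operator subgroup containing them contains the kernel and has an image containing
  \<open>q ` K\<close>.
\<close>

lemma fg_op_normal_tower:
  assumes q: "group_hom F B q" "q ` carrier F = carrier B"
    and eq: "\<And>g w. g \<in> S \<Longrightarrow> w \<in> carrier F \<Longrightarrow> q (\<phi> g w) = \<gamma> g (q w)"
    and L: "kernel F B q \<subseteq> K" "K \<subseteq> carrier F"
    and fg: "fg_op_normal F S \<phi> (kernel F B q)" "fg_op_normal B S \<gamma> (q ` K)"
  shows "fg_op_normal F S \<phi> K"
proof -
  interpret q: group_hom F B q by fact
  obtain W1 where W1: "finite W1" "W1 \<subseteq> kernel F B q"
    "\<And>D. op_normal F S \<phi> D \<Longrightarrow> W1 \<subseteq> D \<Longrightarrow> kernel F B q \<subseteq> D"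
    using fg(1) unfolding fg_op_normal_def by blast
  obtain W2 where W2: "finite W2" "W2 \<subseteq> q ` K"
    "\<And>D. op_normal B S \<gamma> D \<Longrightarrow> W2 \<subseteq> D \<Longrightarrow> q ` K \<subseteq> D"
    using fg(2) unfolding fg_op_normal_def by blast
  obtain V where V: "finite V" "V \<subseteq> K" "W2 = q ` V"
    using finite_subset_image[OF W2(1,2)] by blast
  have "K \<subseteq> D" if D: "op_normal F S \<phi> D" "W1 \<union> V \<subseteq> D" for D
  proof
    interpret D: normal D F using D by (simp add: op_normal_def)
    fix w assume w: "w \<in> K"
    have "op_normal B S \<gamma> (q ` D)"
      using D(1) normal_image[OF q(1) _ q(2), of D] unfolding op_normal_def
      by (force simp: eq[symmetric])
    then have "q ` K \<subseteq> q ` D" using W2(3) V D(2) by blast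
    then obtain d where d: "d \<in> D" "q w = q d" using w by auto
    then have "w \<otimes>\<^bsub>F\<^esub> inv\<^bsub>F\<^esub> d \<in> kernel F B q"
      using w L(2) by (auto simp: kernel_def)
    then have "w \<otimes>\<^bsub>F\<^esub> inv\<^bsub>F\<^esub> d \<otimes>\<^bsub>F\<^esub> d \<in> D"
      using W1(3)[OF D(1)] D(2) d by auto
    then show "w \<in> D" using w d L(2) by (simp add: q.G.m_assoc subset_eq)
  qed
  then show ?thesis unfolding fg_op_normal_def
    using W1(1,2) V(1,2) L(1) by (intro exI[of _ "W1 \<union> V"]) auto
qed

text \<open>
  The map \<open>\<theta>\<close> is equivariant: the operator with index \<open>g\<close> on \<open>E\<close> lies over conjugation by \<open>g\<close> in \<open>G\<close>.
\<close>

definition conj_lift ::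
  "('g, 'n) monoid_scheme \<Rightarrow> 'g set \<Rightarrow> ('e, 'm) monoid_scheme \<Rightarrow> ('e \<Rightarrow> 'g) \<Rightarrow> ('g \<Rightarrow> 'e \<Rightarrow> 'e) \<Rightarrow> bool" where
  "conj_lift G S E \<theta> \<gamma> \<longleftrightarrow> group_hom E G \<theta> \<and>
     (\<forall>g\<in>S. group_hom E E (\<gamma> g) \<and>
        (\<forall>e\<in>carrier E. \<theta> (\<gamma> g e) = g \<otimes>\<^bsub>G\<^esub> \<theta> e \<otimes>\<^bsub>G\<^esub> inv\<^bsub>G\<^esub> g))"

lemma conj_liftD:
  assumes "conj_lift G S E \<theta> \<gamma>"
  shows "group_hom E G \<theta>"
    and "g \<in> S \<Longrightarrow> group_hom E E (\<gamma> g)"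
    and "g \<in> S \<Longrightarrow> e \<in> carrier E \<Longrightarrow> \<theta> (\<gamma> g e) = g \<otimes>\<^bsub>G\<^esub> \<theta> e \<otimes>\<^bsub>G\<^esub> inv\<^bsub>G\<^esub> g"
  using assms unfolding conj_lift_def by auto

lemma op_normal_kernel:
  assumes "conj_lift G S E \<theta> \<gamma>" "S \<subseteq> carrier G"
  shows "op_normal E S \<gamma> (kernel E G \<theta>)"
  unfolding op_normal_def
proof (intro conjI ballI)
  interpret \<theta>: group_hom E G \<theta> using assms(1) by (rule conj_liftD)
  show "kernel E G \<theta> \<lhd> E" by (rule \<theta>.normal_kernel)
  fix g assume g: "g \<in> S"
  interpret \<gamma>: group_hom E E "\<gamma> g" by (rule conj_liftD(2)[OF assms(1) g])
  show "\<gamma> g ` kernel E G \<theta> \<subseteq> kernel E G \<theta>"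
    using g assms(2) by (auto simp: kernel_def conj_liftD(3)[OF assms(1) g])
qed

lemma group_hom_conj:
  assumes "group G" "g \<in> carrier G"
  shows "group_hom G G (\<lambda>x. g \<otimes>\<^bsub>G\<^esub> x \<otimes>\<^bsub>G\<^esub> inv\<^bsub>G\<^esub> g)"
proof -
  interpret group G by fact
  show ?thesis
    by (intro group_homI homI) (use assms in \<open>auto simp: m_assoc inv_solve_left\<close>)
qed

lemma free_group_conj_lift:
  assumes "group_hom (free_group X) G \<pi>" "\<pi> ` carrier (free_group X) \<lhd> G" "S \<subseteq> carrier G"
  obtains \<phi> where "conj_lift G S (free_group X) \<pi> \<phi>"
proof -
  interpret \<pi>: group_hom "free_group X" G \<pi> by fact
  interpret N: normal "\<pi> ` carrier (free_group X)" G by fact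
  have "\<exists>\<phi>. group_hom (free_group X) (free_group X) \<phi> \<and>
    (\<forall>e\<in>carrier (free_group X). \<pi> (\<phi> e) = g \<otimes>\<^bsub>G\<^esub> \<pi> e \<otimes>\<^bsub>G\<^esub> inv\<^bsub>G\<^esub> g)" if "g \<in> S" for g
  proof -
    have g: "g \<in> carrier G" using that assms(3) by auto
    have "(\<lambda>w. g \<otimes>\<^bsub>G\<^esub> \<pi> w \<otimes>\<^bsub>G\<^esub> inv\<^bsub>G\<^esub> g) ` carrier (free_group X) \<subseteq> \<pi> ` carrier (free_group X)"
      using N.inv_op_closed2[OF g] by auto
    then show ?thesis
      using free_group_lift[OF assms(1) group_hom_comp[OF assms(1) group_hom_conj[OF \<pi>.H.is_group g]]]
      by metis
  qed
  then obtain \<phi> where "\<And>g. g \<in> S \<Longrightarrow> group_hom (free_group X) (free_group X) (\<phi> g) \<and>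
    (\<forall>e\<in>carrier (free_group X). \<pi> (\<phi> g e) = g \<otimes>\<^bsub>G\<^esub> \<pi> e \<otimes>\<^bsub>G\<^esub> inv\<^bsub>G\<^esub> g)" by metis
  then show ?thesis using that[of \<phi>] assms(1) by (simp add: conj_lift_def)
qed

section \<open>Presentations with operators\<close>

text \<open>
  The image \<open>N\<close> of \<open>\<pi>\<close> is a quotient of a finitely generated free group by the normal operator closure
  of finitely many relators.
\<close>

definition op_presented :: "('g, 'n) monoid_scheme \<Rightarrow> 'g set \<Rightarrow> 'g set \<Rightarrow> bool" where
  "op_presented G S N \<longleftrightarrow>
     (\<exists>(X :: nat set) \<pi> \<phi>. finite X \<and> conj_lift G S (free_group X) \<pi> \<phi> \<and>
        \<pi> ` carrier (free_group X) = N \<and>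
        fg_op_normal (free_group X) S \<phi> (kernel (free_group X) G \<pi>))"

text \<open>
  Finite generation of the kernel carries over from one free presentation of \<open>N\<close> to every finitely
  generated group \<open>E\<close> with operators over \<open>N\<close>.  Lift \<open>\<pi>\<close> to a homomorphism \<open>\<psi>\<close> from the free group to
  \<open>E\<close>.  The kernel of \<open>\<theta>\<close> is generated by the finitely many elements expressing that \<open>\<psi>\<close> kills the
  relators, that \<open>\<psi>\<close> commutes with the operators on letters, and that each generator of \<open>E\<close> agrees with
  the image of a chosen word having the same value in \<open>N\<close>.
\<close>

lemma op_presented_transfer:
  assumes N: "op_presented G S N" and S: "finite S"
    and E: "conj_lift G S E \<theta> \<gamma>" "\<theta> ` carrier E = N"
    and A: "finite A" "generate E A = carrier E"
  shows "fg_op_normal E S \<gamma> (kernel E G \<theta>)"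
proof -
  obtain X :: "nat set" and \<pi> \<phi> where X: "finite X" and \<pi>: "conj_lift G S (free_group X) \<pi> \<phi>"
    and im: "\<pi> ` carrier (free_group X) = N"
    and fg: "fg_op_normal (free_group X) S \<phi> (kernel (free_group X) G \<pi>)"
    using N unfolding op_presented_def by blast
  let ?F = "free_group X"
  let ?x = "\<lambda>x :: nat. [(x, True)]"
  interpret \<pi>: group_hom ?F G \<pi> using \<pi> by (rule conj_liftD)
  interpret \<theta>: group_hom E G \<theta> using E(1) by (rule conj_liftD)
  obtain \<psi> where \<psi>: "group_hom ?F E \<psi>" and \<theta>\<psi>: "\<And>w. w \<in> carrier ?F \<Longrightarrow> \<theta> (\<psi> w) = \<pi> w"
    using free_group_lift[OF \<theta>.group_hom_axioms \<pi>.group_hom_axioms] im E(2) by auto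
  interpret \<psi>: group_hom ?F E \<psi> by fact
  have AE: "A \<subseteq> carrier E" using A(2) by (auto intro: generate.incl)
  have "\<exists>v\<in>carrier ?F. \<pi> v = \<theta> a" if "a \<in> A" for a
  proof -
    have "\<theta> a \<in> \<pi> ` carrier ?F" using that AE im E(2) by blast
    then show ?thesis by (metis imageE)
  qed
  then obtain v where v: "\<And>a. a \<in> A \<Longrightarrow> v a \<in> carrier ?F \<and> \<pi> (v a) = \<theta> a" by metis
  obtain R where R: "finite R" "R \<subseteq> kernel ?F G \<pi>"
    "\<And>D. op_normal ?F S \<phi> D \<Longrightarrow> R \<subseteq> D \<Longrightarrow> kernel ?F G \<pi> \<subseteq> D"
    using fg unfolding fg_op_normal_def by blast
  have xF: "?x x \<in> carrier ?F" if "x \<in> X" for x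
    using that by (auto simp: carrier_free_group reduced_def)
  define W where "W = \<psi> ` R
    \<union> (\<lambda>(g, x). \<psi> (\<phi> g (?x x)) \<otimes>\<^bsub>E\<^esub> inv\<^bsub>E\<^esub> \<gamma> g (\<psi> (?x x))) ` (S \<times> X)
    \<union> (\<lambda>a. \<psi> (v a) \<otimes>\<^bsub>E\<^esub> inv\<^bsub>E\<^esub> a) ` A"
  have "finite W" unfolding W_def using X R(1) S A(1) by auto
  moreover have "W \<subseteq> kernel E G \<theta>"
  proof -
    have "\<psi> ` R \<subseteq> kernel E G \<theta>"
      using R(2) \<theta>\<psi> by (auto simp: kernel_def)
    moreover have "\<psi> (\<phi> g (?x x)) \<otimes>\<^bsub>E\<^esub> inv\<^bsub>E\<^esub> \<gamma> g (\<psi> (?x x)) \<in> kernel E G \<theta>"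
      if "g \<in> S" "x \<in> X" for g x
    proof -
      interpret \<phi>g: group_hom ?F ?F "\<phi> g" using conj_liftD(2)[OF \<pi> that(1)] .
      interpret \<gamma>g: group_hom E E "\<gamma> g" using conj_liftD(2)[OF E(1) that(1)] .
      have "\<theta> (\<psi> (\<phi> g (?x x))) = \<theta> (\<gamma> g (\<psi> (?x x)))"
        using that xF[OF that(2)] by (simp add: \<theta>\<psi> conj_liftD(3)[OF \<pi>] conj_liftD(3)[OF E(1)])
      then show ?thesis using xF[OF that(2)] by (simp add: kernel_def)
    qed
    moreover have "\<psi> (v a) \<otimes>\<^bsub>E\<^esub> inv\<^bsub>E\<^esub> a \<in> kernel E G \<theta>" if "a \<in> A" for a
      using v[OF that] \<theta>\<psi> that AE by (auto simp: kernel_def subset_eq)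
    ultimately show ?thesis unfolding W_def by auto
  qed
  moreover have "kernel E G \<theta> \<subseteq> D" if D: "op_normal E S \<gamma> D" and WD: "W \<subseteq> D" for D
  proof -
    have Dn: "D \<lhd> E" using D by (simp add: op_normal_def)
    interpret D: normal D E by (rule Dn)
    interpret Q: group "E Mod D" by (rule D.factorgroup_is_group)
    have q: "group_hom E (E Mod D) (\<lambda>e. D #>\<^bsub>E\<^esub> e)"
      by (rule group_homI[OF \<theta>.G.is_group Q.is_group D.r_coset_hom_Mod])
    have qD: "D #>\<^bsub>E\<^esub> e = D #>\<^bsub>E\<^esub> e' \<longleftrightarrow> e \<otimes>\<^bsub>E\<^esub> inv\<^bsub>E\<^esub> e' \<in> D"
      if "e \<in> carrier E" "e' \<in> carrier E" for e e'
      using that by (rule D.rcos_eq_iff)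
    \<comment> \<open>Modulo \<open>D\<close> the lift \<open>\<psi>\<close> is equivariant and kills the relators, so it kills the kernel of \<open>\<pi>\<close>.\<close>
    define P where "P = {w \<in> carrier ?F. \<psi> w \<in> D}"
    have "op_normal ?F S \<phi> P"
      unfolding op_normal_def
    proof (intro conjI ballI)
      show "P \<lhd> ?F" unfolding P_def by (rule normal_vimage[OF \<psi> Dn])
      fix g assume g: "g \<in> S"
      interpret \<phi>g: group_hom ?F ?F "\<phi> g" using conj_liftD(2)[OF \<pi> g] .
      interpret \<gamma>g: group_hom E E "\<gamma> g" using conj_liftD(2)[OF E(1) g] .
      have eq: "D #>\<^bsub>E\<^esub> \<psi> (\<phi> g w) = D #>\<^bsub>E\<^esub> \<gamma> g (\<psi> w)" if "w \<in> carrier ?F" for w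
      proof (rule free_group_hom_eq[OF _ _ _ that])
        show "group_hom ?F (E Mod D) (\<lambda>w. D #>\<^bsub>E\<^esub> \<psi> (\<phi> g w))"
          by (intro group_hom_comp[OF _ q] group_hom_comp[OF _ \<psi>] \<phi>g.group_hom_axioms)
        show "group_hom ?F (E Mod D) (\<lambda>w. D #>\<^bsub>E\<^esub> \<gamma> g (\<psi> w))"
          by (intro group_hom_comp[OF _ q] group_hom_comp[OF \<psi>] \<gamma>g.group_hom_axioms)
        fix x assume "x \<in> X"
        then show "D #>\<^bsub>E\<^esub> \<psi> (\<phi> g (?x x)) = D #>\<^bsub>E\<^esub> \<gamma> g (\<psi> (?x x))"
          using g WD xF by (subst qD) (auto simp: W_def)
      qed
      show "\<phi> g ` P \<subseteq> P"
      proof clarify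
        fix w assume "w \<in> P"
        then have w: "w \<in> carrier ?F" "\<gamma> g (\<psi> w) \<in> D"
          using D g by (auto simp: P_def op_normal_def)
        then have "\<psi> (\<phi> g w) \<otimes>\<^bsub>E\<^esub> inv\<^bsub>E\<^esub> \<gamma> g (\<psi> w) \<otimes>\<^bsub>E\<^esub> \<gamma> g (\<psi> w) \<in> D"
          using eq[OF w(1)] by (subst (asm) qD) auto
        then show "\<phi> g w \<in> P"
          using w(1) by (simp add: P_def \<theta>.G.m_assoc)
      qed
    qed
    moreover have "R \<subseteq> P"
      using R(2) WD by (auto simp: P_def W_def kernel_def)
    ultimately have ker: "kernel ?F G \<pi> \<subseteq> P" by (rule R(3))
    \<comment> \<open>Modulo \<open>D\<close> every element of \<open>E\<close> is the image of a word with the same value in \<open>N\<close>.\<close>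
    define Q where "Q = {e \<in> carrier E. \<exists>w\<in>carrier ?F. \<pi> w = \<theta> e \<and> D #>\<^bsub>E\<^esub> \<psi> w = D #>\<^bsub>E\<^esub> e}"
    interpret q: group_hom E "E Mod D" "\<lambda>e. D #>\<^bsub>E\<^esub> e" by (rule q)
    have "subgroup Q E"
    proof (rule \<theta>.G.subgroupI)
      show "Q \<subseteq> carrier E" by (auto simp: Q_def)
      have "\<one>\<^bsub>E\<^esub> \<in> Q" unfolding Q_def by (auto intro!: bexI[of _ "\<one>\<^bsub>?F\<^esub>"])
      then show "Q \<noteq> {}" by auto
    next
      fix e assume "e \<in> Q"
      then obtain w where w: "e \<in> carrier E" "w \<in> carrier ?F" "\<pi> w = \<theta> e" "D #>\<^bsub>E\<^esub> \<psi> w = D #>\<^bsub>E\<^esub> e"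
        by (auto simp: Q_def)
      then have "D #>\<^bsub>E\<^esub> \<psi> (inv\<^bsub>?F\<^esub> w) = D #>\<^bsub>E\<^esub> inv\<^bsub>E\<^esub> e"
        by (metis \<psi>.hom_inv \<psi>.hom_closed q.hom_inv)
      with w show "inv\<^bsub>E\<^esub> e \<in> Q"
        unfolding Q_def by (auto intro!: bexI[of _ "inv\<^bsub>?F\<^esub> w"])
    next
      fix e e' assume "e \<in> Q" "e' \<in> Q"
      then obtain w w' where w: "e \<in> carrier E" "w \<in> carrier ?F" "\<pi> w = \<theta> e" "D #>\<^bsub>E\<^esub> \<psi> w = D #>\<^bsub>E\<^esub> e"
         "e' \<in> carrier E" "w' \<in> carrier ?F" "\<pi> w' = \<theta> e'" "D #>\<^bsub>E\<^esub> \<psi> w' = D #>\<^bsub>E\<^esub> e'"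
        by (auto simp: Q_def)
      then have "D #>\<^bsub>E\<^esub> \<psi> (w \<otimes>\<^bsub>?F\<^esub> w') = D #>\<^bsub>E\<^esub> (e \<otimes>\<^bsub>E\<^esub> e')"
        by (metis \<psi>.hom_mult \<psi>.hom_closed q.hom_mult)
      with w show "e \<otimes>\<^bsub>E\<^esub> e' \<in> Q"
        unfolding Q_def by (auto intro!: bexI[of _ "w \<otimes>\<^bsub>?F\<^esub> w'"])
    qed
    moreover have "A \<subseteq> Q"
    proof
      fix a assume a: "a \<in> A"
      then have "D #>\<^bsub>E\<^esub> \<psi> (v a) = D #>\<^bsub>E\<^esub> a"
        using v[OF a] AE WD by (subst qD) (auto simp: W_def)
      then show "a \<in> Q" using a v[OF a] AE by (auto simp: Q_def)
    qed
    ultimately have Q: "carrier E \<subseteq> Q"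
      using \<theta>.G.generate_subgroup_incl A(2) by blast
    show ?thesis
    proof
      fix e assume e: "e \<in> kernel E G \<theta>"
      then obtain w where w: "w \<in> carrier ?F" "\<pi> w = \<theta> e" "D #>\<^bsub>E\<^esub> \<psi> w = D #>\<^bsub>E\<^esub> e"
        using Q by (auto simp: Q_def kernel_def)
      then have "\<psi> w \<in> D" using ker e by (auto simp: P_def kernel_def)
      moreover have "e \<otimes>\<^bsub>E\<^esub> inv\<^bsub>E\<^esub> \<psi> w \<in> D"
        using w e by (subst qD[symmetric]) (auto simp: kernel_def)
      ultimately have "e \<otimes>\<^bsub>E\<^esub> inv\<^bsub>E\<^esub> \<psi> w \<otimes>\<^bsub>E\<^esub> \<psi> w \<in> D" by blast
      then show "e \<in> D" using e w by (simp add: kernel_def \<theta>.G.m_assoc)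
    qed
  qed
  ultimately show ?thesis unfolding fg_op_normal_def by blast
qed

lemma op_presented_finitely_generated:
  assumes "op_presented G S N"
  obtains A where "finite A" "A \<subseteq> carrier G" "generate G A = N"
proof -
  obtain X :: "nat set" and \<pi> \<phi> where X: "finite X" "conj_lift G S (free_group X) \<pi> \<phi>"
    "\<pi> ` carrier (free_group X) = N"
    using assms unfolding op_presented_def by blast
  let ?x = "\<lambda>x :: nat. [(x, True)]"
  interpret \<pi>: group_hom "free_group X" G \<pi> using X(2) by (rule conj_liftD)
  have xs: "?x ` X \<subseteq> carrier (free_group X)"
    unfolding free_group_generated[symmetric] by (auto intro: generate.incl)
  then have "generate G (\<pi> ` ?x ` X) = N"
    by (simp only: \<pi>.generate_img free_group_generated X(3))
  moreover have "\<pi> ` ?x ` X \<subseteq> carrier G" using xs by auto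
  ultimately show ?thesis using X(1) by (intro that[of "\<pi> ` ?x ` X"]) auto
qed

text \<open>
  The whole group is normal, so conjugations lift; invariance under the lifts only shrinks the class of
  subgroups \<open>D\<close> to be tested, so the defining relators suffice whatever the lifts are.
\<close>

lemma finitely_presented_imp_op_presented:
  assumes "finitely_presented G" "S \<subseteq> carrier G"
  shows "op_presented G S (carrier G)"
proof -
  obtain X :: "nat set" and R where X: "finite X" "finite R" "R \<subseteq> carrier (free_group X)"
    and iso: "G \<cong> free_group X Mod normal_closure (free_group X) R" and G: "group G"
    using assms(1) unfolding finitely_presented_def by blast
  let ?F = "free_group X"
  let ?K = "normal_closure ?F R"
  interpret F: group ?F by (rule group_free_group)
  interpret G: group G by (rule G)
  have Kn: "?K \<lhd> ?F" by (rule F.normal_normal_closure[OF X(3)])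
  interpret K: normal ?K ?F by (rule Kn)
  interpret Q: group "?F Mod ?K" by (rule K.factorgroup_is_group)
  obtain f where f: "f \<in> iso (?F Mod ?K) G"
    using G.iso_sym[OF iso] by (auto simp: is_iso_def)
  have fhom: "group_hom (?F Mod ?K) G f"
    using f by (intro group_homI Q.is_group G) (simp add: iso_def)
  have q: "group_hom ?F (?F Mod ?K) (\<lambda>w. ?K #>\<^bsub>?F\<^esub> w)"
    by (rule group_homI[OF group_free_group Q.is_group K.r_coset_hom_Mod])
  define \<pi> where "\<pi> w = f (?K #>\<^bsub>?F\<^esub> w)" for w
  have \<pi>: "group_hom ?F G \<pi>" unfolding \<pi>_def by (rule group_hom_comp[OF q fhom])
  have im: "\<pi> ` carrier ?F = carrier G"
    using f unfolding \<pi>_def iso_def bij_betw_def by (auto simp: carrier_FactGroup image_image)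
  have ker: "kernel ?F G \<pi> \<subseteq> ?K"
  proof
    fix w assume w: "w \<in> kernel ?F G \<pi>"
    then have "f (?K #>\<^bsub>?F\<^esub> w) = f \<one>\<^bsub>?F Mod ?K\<^esub>" "w \<in> carrier ?F"
      using group_hom.hom_one[OF fhom] by (simp_all add: \<pi>_def kernel_def)
    moreover have "inj_on f (carrier (?F Mod ?K))" using f by (simp add: iso_def bij_betw_def)
    ultimately have "?K #>\<^bsub>?F\<^esub> w = \<one>\<^bsub>?F Mod ?K\<^esub>"
      by (elim inj_onD) (simp_all add: carrier_FactGroup Q.one_closed[unfolded carrier_FactGroup] del: one_FactGroup)
    then show "w \<in> ?K" using w F.rcos_self[OF _ normal_imp_subgroup[OF Kn]] by (auto simp: kernel_def)
  qed
  have RK: "R \<subseteq> kernel ?F G \<pi>"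
  proof
    fix r assume r: "r \<in> R"
    then have "r \<in> ?K" unfolding normal_closure_def by blast
    then have "?K #>\<^bsub>?F\<^esub> r = \<one>\<^bsub>?F Mod ?K\<^esub>"
      by (simp add: K.rcos_const)
    then show "r \<in> kernel ?F G \<pi>"
      using r X(3) group_hom.hom_one[OF fhom] by (auto simp: kernel_def \<pi>_def)
  qed
  obtain \<phi> where \<phi>: "conj_lift G S ?F \<pi> \<phi>"
    using free_group_conj_lift[OF \<pi> _ assms(2)] unfolding im
    using G.subgroup_self by (metis G.normal_inv_iff G.m_closed G.inv_closed)
  have "fg_op_normal ?F S \<phi> (kernel ?F G \<pi>)"
    unfolding fg_op_normal_def
  proof (intro exI conjI allI impI)
    fix D assume "op_normal ?F S \<phi> D" "R \<subseteq> D"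
    then have "?K \<subseteq> D" unfolding normal_closure_def op_normal_def by blast
    with ker show "kernel ?F G \<pi> \<subseteq> D" by blast
  qed (use X RK in auto)
  then show ?thesis unfolding op_presented_def using X(1) \<phi> im by blast
qed

text \<open>
  Without fixed relations the kernel of an \<open>L\<close>-presentation is the least normal subgroup that contains the
  iterated relations and is invariant under the substitutions, which is what \<open>op_presented\<close> asks for.
\<close>

lemma op_presented_imp_L_presented:
  assumes N: "op_presented G S N" and S: "finite S" "S \<subseteq> carrier G" and sub: "subgroup N G"
  shows "invariantly_finitely_L_presented (G\<lparr>carrier := N\<rparr>)"
proof -
  obtain X :: "nat set" and \<pi> \<phi> where X: "finite X" and \<phi>: "conj_lift G S (free_group X) \<pi> \<phi>"
    and im: "\<pi> ` carrier (free_group X) = N"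
    and fg: "fg_op_normal (free_group X) S \<phi> (kernel (free_group X) G \<pi>)"
    using N unfolding op_presented_def by blast
  let ?F = "free_group X"
  interpret \<pi>: group_hom ?F G \<pi> using \<phi> by (rule conj_liftD)
  obtain R where R: "finite R" "R \<subseteq> kernel ?F G \<pi>"
    "\<And>D. op_normal ?F S \<phi> D \<Longrightarrow> R \<subseteq> D \<Longrightarrow> kernel ?F G \<pi> \<subseteq> D"
    using fg unfolding fg_op_normal_def by blast
  define P where "P = \<lparr>generators = X, fixed_relations = {}, substitutions = \<phi> ` S, iterated_relations = R\<rparr>"
  define U where "U = (\<Union>\<sigma>\<in>generated_monoid (\<phi> ` S). \<sigma> ` R)"
  have K: "L_kernel P = normal_closure ?F U"
    unfolding L_kernel_def P_def U_def by simp
  have kn: "op_normal ?F S \<phi> (kernel ?F G \<pi>)" by (rule op_normal_kernel[OF \<phi> S(2)])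
  have inv: "\<sigma> ` kernel ?F G \<pi> \<subseteq> kernel ?F G \<pi>" if "\<sigma> \<in> generated_monoid (\<phi> ` S)" for \<sigma>
    using that
  proof induction
    case (incl \<psi>)
    then show ?case using kn unfolding op_normal_def by blast
  next
    case (comp \<sigma> \<tau>)
    then show ?case by (auto simp: image_subset_iff)
  qed auto
  then have U: "U \<subseteq> kernel ?F G \<pi>" using R(2) unfolding U_def by blast
  have UF: "U \<subseteq> carrier ?F" using U by (auto simp: kernel_def)
  have Kn: "normal_closure ?F U \<lhd> ?F" by (rule \<pi>.G.normal_normal_closure[OF UF])
  have Kmin: "normal_closure ?F U \<subseteq> D" if "D \<lhd> ?F" "U \<subseteq> D" for D
    using that unfolding normal_closure_def by blast
  have UK: "U \<subseteq> normal_closure ?F U" unfolding normal_closure_def by blast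
  have Kinv: "\<phi> g ` normal_closure ?F U \<subseteq> normal_closure ?F U" if g: "g \<in> S" for g
  proof -
    have "\<phi> g ` U \<subseteq> U"
    proof
      fix v assume "v \<in> \<phi> g ` U"
      then obtain \<sigma> r where v: "\<sigma> \<in> generated_monoid (\<phi> ` S)" "r \<in> R" "v = (\<phi> g \<circ> \<sigma>) r"
        unfolding U_def by auto
      then show "v \<in> U"
        unfolding U_def using g generated_monoid.comp[OF generated_monoid.incl[of "\<phi> g"] v(1)] by blast
    qed
    then have "U \<subseteq> {w \<in> carrier ?F. \<phi> g w \<in> normal_closure ?F U}"
      using UK UF by blast
    from Kmin[OF normal_vimage[OF conj_liftD(2)[OF \<phi> g] Kn] this] show ?thesis by blast
  qed
  have "normal_closure ?F U = kernel ?F G \<pi>"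
  proof
    show "normal_closure ?F U \<subseteq> kernel ?F G \<pi>"
      by (rule Kmin[OF \<pi>.normal_kernel U])
    have "id ` R \<subseteq> U" unfolding U_def by (rule UN_upper[OF generated_monoid.id])
    then have "R \<subseteq> U" by simp
    then show "kernel ?F G \<pi> \<subseteq> normal_closure ?F U"
      using UK Kn Kinv by (intro R(3)) (auto simp: op_normal_def)
  qed
  then have KP: "L_kernel P = kernel ?F G \<pi>" by (simp add: K)
  have NG: "group (G\<lparr>carrier := N\<rparr>)" by (rule \<pi>.H.subgroup_imp_group[OF sub])
  have \<pi>N: "group_hom ?F (G\<lparr>carrier := N\<rparr>) \<pi>"
    using im by (intro group_homI group_free_group NG homI) auto
  interpret \<pi>N: group_hom ?F "G\<lparr>carrier := N\<rparr>" \<pi> by (rule \<pi>N)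
  have "?F Mod kernel ?F (G\<lparr>carrier := N\<rparr>) \<pi> \<cong> G\<lparr>carrier := N\<rparr>"
    by (rule \<pi>N.FactGroup_iso) (simp add: im)
  then have "L_group P \<cong> G\<lparr>carrier := N\<rparr>"
    unfolding L_group_def KP by (simp add: P_def kernel_def)
  moreover have "group (L_group P)"
    unfolding L_group_def KP using \<pi>.normal_kernel by (simp add: P_def normal.factorgroup_is_group)
  ultimately have "G\<lparr>carrier := N\<rparr> \<cong> L_group P" by (simp add: group.iso_sym)
  moreover have "L_presentation P"
    using R(2) group_hom.homh[OF conj_liftD(2)[OF \<phi>]] by (auto simp: L_presentation_def P_def kernel_def)
  moreover have "finite_L_pres P"
    using X S(1) R(1) by (simp add: finite_L_pres_def P_def)
  moreover have "invariant_L_pres P"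
    unfolding invariant_L_pres_def K using Kinv by (auto simp: P_def)
  ultimately show ?thesis
    unfolding invariantly_finitely_L_presented_def using NG by blast
qed

section \<open>Semidirect products with the integers\<close>

text \<open>
  The pair \<open>(x, i)\<close> stands for \<open>x t\<^sup>i\<close>, where \<open>t\<close> acts on \<open>B\<close> by \<open>\<alpha> 1\<close>.
\<close>

definition int_semidirect ::
  "('b, 'm) monoid_scheme \<Rightarrow> (int \<Rightarrow> 'b \<Rightarrow> 'b) \<Rightarrow> ('b \<times> int) monoid" where
  "int_semidirect B \<alpha> =
     \<lparr>carrier = carrier B \<times> UNIV,
      monoid.mult = (\<lambda>(x, i) (y, j). (x \<otimes>\<^bsub>B\<^esub> \<alpha> i y, i + j)),
      one = (\<one>\<^bsub>B\<^esub>, 0)\<rparr>"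

locale int_action = B: group B for B (structure) +
  fixes \<alpha> :: "int \<Rightarrow> 'a \<Rightarrow> 'a"
  assumes act_hom: "group_hom B B (\<alpha> i)"
    and act_add: "x \<in> carrier B \<Longrightarrow> \<alpha> (i + j) x = \<alpha> i (\<alpha> j x)"
    and act_zero: "x \<in> carrier B \<Longrightarrow> \<alpha> 0 x = x"
begin

abbreviation "E \<equiv> int_semidirect B \<alpha>"

lemma E_simps [simp]:
  "carrier E = carrier B \<times> UNIV"
  "(x, i) \<otimes>\<^bsub>E\<^esub> (y, j) = (x \<otimes> \<alpha> i y, i + j)"
  "\<one>\<^bsub>E\<^esub> = (\<one>, 0)"
  by (simp_all add: int_semidirect_def)

lemma act_simps [simp]:
  "x \<in> carrier B \<Longrightarrow> \<alpha> i x \<in> carrier B"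
  "x \<in> carrier B \<Longrightarrow> y \<in> carrier B \<Longrightarrow> \<alpha> i (x \<otimes> y) = \<alpha> i x \<otimes> \<alpha> i y"
  "x \<in> carrier B \<Longrightarrow> \<alpha> i (inv x) = inv \<alpha> i x"
  "\<alpha> i \<one> = \<one>"
  "x \<in> carrier B \<Longrightarrow> \<alpha> 0 x = x"
proof -
  interpret a: group_hom B B "\<alpha> i" by (rule act_hom)
  show "x \<in> carrier B \<Longrightarrow> \<alpha> i x \<in> carrier B"
    "x \<in> carrier B \<Longrightarrow> y \<in> carrier B \<Longrightarrow> \<alpha> i (x \<otimes> y) = \<alpha> i x \<otimes> \<alpha> i y"
    "x \<in> carrier B \<Longrightarrow> \<alpha> i (inv x) = inv \<alpha> i x"
    "\<alpha> i \<one> = \<one>"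
    by simp_all
qed (rule act_zero)

lemma act_cancel:
  "x \<in> carrier B \<Longrightarrow> \<alpha> i (\<alpha> (- i) x) = x" "x \<in> carrier B \<Longrightarrow> \<alpha> (- i) (\<alpha> i x) = x"
  using act_add[of x i "- i"] act_add[of x "- i" i] by simp_all

lemma group_E: "group E"
proof (rule groupI)
  fix u assume "u \<in> carrier E"
  then obtain x i where u: "u = (x, i)" "x \<in> carrier B" by auto
  then show "\<exists>v\<in>carrier E. v \<otimes>\<^bsub>E\<^esub> u = \<one>\<^bsub>E\<^esub>"
    by (intro bexI[of _ "(\<alpha> (- i) (inv x), - i)"]) auto
qed (auto simp: B.m_assoc act_add)

sublocale E: group E by (rule group_E)

lemma E_inv [simp]: "x \<in> carrier B \<Longrightarrow> inv\<^bsub>E\<^esub> (x, i) = (\<alpha> (- i) (inv x), - i)"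
  by (rule E.inv_equality) auto

lemma base_hom: "group_hom B E (\<lambda>x. (x, 0))"
  by (intro group_homI homI B.is_group group_E) auto

lemma snd_hom: "group_hom E integer_group snd"
  by (intro group_homI homI group_E group_integer_group) auto

lemma snd_pow: "u \<in> carrier E \<Longrightarrow> snd (u [^]\<^bsub>E\<^esub> (k :: int)) = k * snd u"
  using group_hom.hom_int_pow[OF snd_hom, of u k] by simp

lemma snd_mult: "snd (u \<otimes>\<^bsub>E\<^esub> v) = snd u + snd v"
  by (cases u; cases v) simp

lemma snd_inv: "u \<in> carrier E \<Longrightarrow> snd (inv\<^bsub>E\<^esub> u) = - snd u"
  by (cases u) simp

lemma stable_pow: "(\<one>, 1) [^]\<^bsub>E\<^esub> (k :: int) = (\<one>, k)"
proof (induction k rule: int_induct[where k = 0])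
  case (step1 i)
  then show ?case by (simp add: E.int_pow_mult)
next
  case (step2 i)
  have "(\<one>, 1) [^]\<^bsub>E\<^esub> (i - 1) = (\<one>, 1) [^]\<^bsub>E\<^esub> i \<otimes>\<^bsub>E\<^esub> (\<one>, 1) [^]\<^bsub>E\<^esub> (- 1 :: int)"
    using E.int_pow_mult[of "(\<one>, 1)" i "-1"] by simp
  then show ?case using step2 by (simp add: E.int_pow_neg)
qed simp

lemma E_generated:
  assumes "generate B A = carrier B"
  shows "generate E (insert (\<one>, 1) ((\<lambda>x. (x, 0)) ` A)) = carrier E" (is "generate E ?A = _")
proof
  have A: "A \<subseteq> carrier B" using assms by (auto intro: generate.incl)
  then have A': "?A \<subseteq> carrier E" by auto
  then show "generate E ?A \<subseteq> carrier E" by (rule E.generate_incl)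
  interpret Q: subgroup "generate E ?A" E by (rule E.generate_is_subgroup[OF A'])
  interpret incl: group_hom B E "\<lambda>x. (x, 0)" by (rule base_hom)
  have "(\<lambda>x. (x, 0)) ` generate B A = generate E ((\<lambda>x. (x, 0)) ` A)"
    by (rule incl.generate_img[symmetric, OF A])
  also have "\<dots> \<subseteq> generate E ?A" by (rule E.mono_generate) auto
  finally have 1: "(x, 0) \<in> generate E ?A" if "x \<in> carrier B" for x using that assms by auto
  have "(\<one>, 1) [^]\<^bsub>E\<^esub> i \<in> generate E ?A" for i :: int
    by (rule E.subgroup_int_pow_closed[OF Q.subgroup_axioms]) (auto intro: generate.incl)
  then have 2: "(\<one>, i) \<in> generate E ?A" for i by (simp add: stable_pow)
  show "carrier E \<subseteq> generate E ?A"
  proof clarify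
    fix x i assume "(x, i) \<in> carrier E"
    then show "(x, i) \<in> generate E ?A"
      using Q.m_closed[OF 1[of x] 2[of i]] by simp
  qed
qed

lemma lift_commute:
  assumes f: "group_hom B C f" and s: "s \<in> carrier C"
    and rel: "\<And>x. x \<in> carrier B \<Longrightarrow> s \<otimes>\<^bsub>C\<^esub> f x = f (\<alpha> 1 x) \<otimes>\<^bsub>C\<^esub> s"
  shows "x \<in> carrier B \<Longrightarrow> s [^]\<^bsub>C\<^esub> (i :: int) \<otimes>\<^bsub>C\<^esub> f x = f (\<alpha> i x) \<otimes>\<^bsub>C\<^esub> s [^]\<^bsub>C\<^esub> i"
proof (induction i arbitrary: x rule: int_induct[where k = 0])
  interpret f: group_hom B C f by (rule f)
  { case base
    then show ?case by simp }
  { case (step1 i)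
    have "s [^]\<^bsub>C\<^esub> (i + 1) \<otimes>\<^bsub>C\<^esub> f x = s [^]\<^bsub>C\<^esub> i \<otimes>\<^bsub>C\<^esub> f (\<alpha> 1 x) \<otimes>\<^bsub>C\<^esub> s"
      using s step1.prems rel by (simp add: f.H.int_pow_mult f.H.m_assoc)
    also have "\<dots> = f (\<alpha> (i + 1) x) \<otimes>\<^bsub>C\<^esub> s [^]\<^bsub>C\<^esub> (i + 1)"
      using s step1 by (simp add: f.H.int_pow_mult f.H.m_assoc act_add)
    finally show ?case . }
  { case (step2 i)
    define y where "y = \<alpha> (- 1) x"
    have y: "y \<in> carrier B" "x = \<alpha> 1 y" "\<alpha> i y = \<alpha> (i - 1) x"
      using step2.prems act_add[of x i "- 1"] by (auto simp: y_def act_cancel)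
    have pow: "s [^]\<^bsub>C\<^esub> i = s [^]\<^bsub>C\<^esub> (i - 1) \<otimes>\<^bsub>C\<^esub> s"
      using f.H.int_pow_mult[OF s, of "i - 1" 1] s by simp
    have "s [^]\<^bsub>C\<^esub> (i - 1) \<otimes>\<^bsub>C\<^esub> f x \<otimes>\<^bsub>C\<^esub> s = s [^]\<^bsub>C\<^esub> i \<otimes>\<^bsub>C\<^esub> f y"
      using s y rel[OF y(1)] by (simp add: pow f.H.m_assoc)
    also have "\<dots> = f (\<alpha> (i - 1) x) \<otimes>\<^bsub>C\<^esub> s [^]\<^bsub>C\<^esub> i"
      using step2.IH[OF y(1)] y(3) by simp
    also have "\<dots> = f (\<alpha> (i - 1) x) \<otimes>\<^bsub>C\<^esub> s [^]\<^bsub>C\<^esub> (i - 1) \<otimes>\<^bsub>C\<^esub> s"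
      using s step2.prems by (simp add: pow f.H.m_assoc)
    finally show ?case using s step2.prems by simp }
qed

text \<open>
  The universal property of the semidirect product: a homomorphism on \<open>B\<close> and an image \<open>s\<close> of the stable
  letter that induces the prescribed action extend together.
\<close>

lemma lift_hom:
  assumes f: "group_hom B C f" and s: "s \<in> carrier C"
    and rel: "\<And>x. x \<in> carrier B \<Longrightarrow> s \<otimes>\<^bsub>C\<^esub> f x = f (\<alpha> 1 x) \<otimes>\<^bsub>C\<^esub> s"
  shows "group_hom E C (\<lambda>(x, i). f x \<otimes>\<^bsub>C\<^esub> s [^]\<^bsub>C\<^esub> i)"
proof -
  interpret f: group_hom B C f by (rule f)
  show ?thesis
  proof (intro group_homI homI group_E f.H.is_group)
    fix u v assume "u \<in> carrier E" "v \<in> carrier E"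
    then obtain x i y j where u: "u = (x, i)" "v = (y, j)" "x \<in> carrier B" "y \<in> carrier B" by auto
    have "f x \<otimes>\<^bsub>C\<^esub> s [^]\<^bsub>C\<^esub> i \<otimes>\<^bsub>C\<^esub> (f y \<otimes>\<^bsub>C\<^esub> s [^]\<^bsub>C\<^esub> j)
      = f x \<otimes>\<^bsub>C\<^esub> (s [^]\<^bsub>C\<^esub> i \<otimes>\<^bsub>C\<^esub> f y) \<otimes>\<^bsub>C\<^esub> s [^]\<^bsub>C\<^esub> j"
      using u s by (simp add: f.H.m_assoc)
    also have "s [^]\<^bsub>C\<^esub> i \<otimes>\<^bsub>C\<^esub> f y = f (\<alpha> i y) \<otimes>\<^bsub>C\<^esub> s [^]\<^bsub>C\<^esub> i"
      by (rule lift_commute[OF f s rel u(4)])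
    finally show "(case u \<otimes>\<^bsub>E\<^esub> v of (x, i) \<Rightarrow> f x \<otimes>\<^bsub>C\<^esub> s [^]\<^bsub>C\<^esub> i) =
      (case u of (x, i) \<Rightarrow> f x \<otimes>\<^bsub>C\<^esub> s [^]\<^bsub>C\<^esub> i) \<otimes>\<^bsub>C\<^esub> (case v of (x, i) \<Rightarrow> f x \<otimes>\<^bsub>C\<^esub> s [^]\<^bsub>C\<^esub> i)"
      using u s by (simp add: f.H.m_assoc f.H.int_pow_mult)
  qed (use s in auto)
qed

lemma base_normal:
  assumes "P \<lhd> B" "\<alpha> 1 ` P \<subseteq> P" "\<alpha> (- 1) ` P \<subseteq> P"
  shows "P \<times> {0} \<lhd> E"
proof -
  interpret P: normal P B by fact
  have act: "\<alpha> i p \<in> P" if "p \<in> P" for i p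
    using that
  proof (induction i arbitrary: p rule: int_induct[where k = 0])
    case (step1 i)
    then show ?case using assms(2) by (simp add: act_add image_subset_iff)
  next
    case (step2 i)
    then show ?case using assms(3) act_add[of p i "- 1"] by (simp add: image_subset_iff)
  qed simp
  show ?thesis
    unfolding E.normal_inv_iff
  proof (intro conjI ballI)
    have "(\<lambda>x. (x, 0 :: int)) ` P = P \<times> {0}" by auto
    then show "subgroup (P \<times> {0}) E"
      using group_hom.subgroup_img_is_subgroup[OF base_hom P.subgroup_axioms] by simp
    fix u h assume "u \<in> carrier E" "h \<in> P \<times> {0 :: int}"
    then obtain x i p where u: "u = (x, i)" "x \<in> carrier B" "h = (p, 0)" "p \<in> P" by auto
    have "x \<otimes> \<alpha> i p \<otimes> inv x \<in> P"
      using u act by (intro P.inv_op_closed2) auto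
    then show "u \<otimes>\<^bsub>E\<^esub> h \<otimes>\<^bsub>E\<^esub> inv\<^bsub>E\<^esub> u \<in> P \<times> {0}"
      using u by (simp add: act_cancel)
  qed
qed

end

text \<open>
  Nonnegative exponents iterate \<open>f\<close>, negative ones iterate \<open>f'\<close>.
\<close>

lemma int_action_of_inverses:
  assumes f: "group_hom B B f" "group_hom B B f'"
    and inv: "\<And>x. x \<in> carrier B \<Longrightarrow> f (f' x) = x" "\<And>x. x \<in> carrier B \<Longrightarrow> f' (f x) = x"
  obtains \<alpha> where "int_action B \<alpha>" "\<alpha> 1 = f" "\<alpha> (- 1) = f'"
proof -
  interpret f: group_hom B B f by fact
  interpret f': group_hom B B f' by fact
  define \<alpha> :: "int \<Rightarrow> 'a \<Rightarrow> 'a" where "\<alpha> i = (if 0 \<le> i then f ^^ nat i else f' ^^ nat (- i))" for i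
  have pow_hom: "group_hom B B (h ^^ n)" if "group_hom B B h" for h and n
  proof (induction n)
    case 0
    show ?case by (intro group_homI homI f.G.is_group) auto
  next
    case (Suc n)
    then show ?case using group_hom_comp[OF Suc that] by (simp add: o_def)
  qed
  have hom: "group_hom B B (\<alpha> i)" for i
    unfolding \<alpha>_def using pow_hom f by simp
  have succ: "\<alpha> (i + 1) x = f (\<alpha> i x)" if x: "x \<in> carrier B" for i x
  proof (cases "0 \<le> i")
    case True
    then show ?thesis by (simp add: \<alpha>_def nat_add_distrib)
  next
    case False
    then obtain n where n: "i = - int (Suc n)"
      by (metis negD not_le_imp_less)
    have "(f' ^^ n) x \<in> carrier B"
      using pow_hom[OF f(2), of n] x by (rule group_hom.hom_closed)
    moreover have "\<alpha> (i + 1) = f' ^^ n" 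
    proof (cases n)
      case (Suc m)
      then have "nat (- (i + 1)) = n" "\<not> 0 \<le> i + 1" using n by simp_all
      then show ?thesis by (simp only: \<alpha>_def if_False)
    qed (simp add: \<alpha>_def n)
    moreover have "\<alpha> i = f' ^^ Suc n" 
    proof -
      have "nat (- i) = Suc n" "\<not> 0 \<le> i" using n by simp_all
      then show ?thesis by (simp only: \<alpha>_def if_False)
    qed
    ultimately show ?thesis by (simp add: inv)
  qed
  have cl: "\<alpha> i x \<in> carrier B" if "x \<in> carrier B" for i x
    using hom that by (rule group_hom.hom_closed)
  have pred: "\<alpha> (i - 1) x = f' (\<alpha> i x)" if x: "x \<in> carrier B" for i x
    using succ[OF x, of "i - 1"] cl[OF x, of "i - 1"] inv(2) by simp
  have zero: "\<alpha> 0 x = x" for x by (simp add: \<alpha>_def)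
  have add: "\<alpha> (i + j) x = \<alpha> i (\<alpha> j x)" if x: "x \<in> carrier B" for i j x
  proof (induction i rule: int_induct[where k = 0])
    case base
    then show ?case by (simp add: \<alpha>_def)
  next
    case (step1 i)
    have "\<alpha> (i + j + 1) x = \<alpha> (i + 1) (\<alpha> j x)"
      using step1 succ x cl by simp
    then show ?case by (simp add: algebra_simps)
  next
    case (step2 i)
    have "\<alpha> (i + j - 1) x = \<alpha> (i - 1) (\<alpha> j x)"
      using step2 pred x cl by simp
    then show ?case by (simp add: algebra_simps)
  qed
  show ?thesis
  proof
    show "int_action B \<alpha>"
      by (intro int_action.intro int_action_axioms.intro f.G.is_group hom add zero)
    show "\<alpha> 1 = f" "\<alpha> (- 1) = f'" by (simp_all add: \<alpha>_def)
  qed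
qed

section \<open>Descending along a cyclic quotient\<close>

text \<open>
  The kernel of \<open>B \<rightarrow> M\<close> inherits finite generation from the kernel of \<open>E \<rightarrow> N\<close>, where \<open>E\<close> is the
  semidirect product of \<open>B\<close> with an infinite cyclic group.  The assumption on \<open>m\<close> and \<open>\<beta>\<close> is exactly
  what extends the operators to \<open>E\<close> by \<open>t \<mapsto> m\<^sub>g t\<close>.  Every element \<open>e\<close> of the kernel of \<open>E \<rightarrow> N\<close> is
  \<open>u e\<close> times a power of \<open>c\<close>, with \<open>u e\<close> in the kernel of \<open>B \<rightarrow> M\<close>.  The generators for the latter are
  the parts \<open>u e\<close> of generators \<open>e\<close> of the former, together with the finitely many elements whose vanishing
  makes \<open>c\<close> central and invariant under the operators.
\<close>

lemma fg_op_normal_descend: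
  assumes act: "int_action B \<alpha>" and \<beta>: "conj_lift G S B \<rho> \<beta>"
    and S: "finite S" "S \<subseteq> carrier G" "t \<in> S" "inv\<^bsub>G\<^esub> t \<in> S"
    and \<alpha>: "\<alpha> 1 = \<beta> t" "\<alpha> (- 1) = \<beta> (inv\<^bsub>G\<^esub> t)"
    and m: "\<And>g. g \<in> S \<Longrightarrow> m g \<in> carrier B"
      "\<And>g. g \<in> S \<Longrightarrow> \<rho> (m g) = g \<otimes>\<^bsub>G\<^esub> t \<otimes>\<^bsub>G\<^esub> inv\<^bsub>G\<^esub> g \<otimes>\<^bsub>G\<^esub> inv\<^bsub>G\<^esub> t"
    and rel: "\<And>g x. g \<in> S \<Longrightarrow> x \<in> carrier B \<Longrightarrow>
      m g \<otimes>\<^bsub>B\<^esub> \<beta> t (\<beta> g x) = \<beta> g (\<beta> t x) \<otimes>\<^bsub>B\<^esub> m g"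
    and A: "finite A" "generate B A = carrier B"
    and N: "op_presented G S N"
      "N = {\<rho> x \<otimes>\<^bsub>G\<^esub> t [^]\<^bsub>G\<^esub> (i :: int) | x i. x \<in> carrier B}"
  shows "fg_op_normal B S \<beta> (kernel B G \<rho>)"
proof -
  interpret int_action B \<alpha> by (rule act)
  interpret \<rho>: group_hom B G \<rho> using \<beta> by (rule conj_liftD)
  have tG: "t \<in> carrier G" using S by auto
  define \<theta> where "\<theta> = (\<lambda>(x, i :: int). \<rho> x \<otimes>\<^bsub>G\<^esub> t [^]\<^bsub>G\<^esub> i)"
  have \<theta>: "group_hom E G \<theta>"
    unfolding \<theta>_def
    by (rule lift_hom[OF \<rho>.group_hom_axioms tG])
      (use tG in \<open>simp add: \<alpha> conj_liftD(3)[OF \<beta> S(3)] \<rho>.H.m_assoc\<close>)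
  interpret \<theta>: group_hom E G \<theta> by (rule \<theta>)
  define \<gamma> where "\<gamma> g = (\<lambda>(x, i :: int). (\<beta> g x, 0) \<otimes>\<^bsub>E\<^esub> (m g, 1) [^]\<^bsub>E\<^esub> i)" for g
  have \<gamma>: "conj_lift G S E \<theta> \<gamma>"
    unfolding conj_lift_def
  proof (intro conjI ballI \<theta>)
    fix g assume g: "g \<in> S"
    then have gG: "g \<in> carrier G" using S by auto
    interpret \<beta>g: group_hom B B "\<beta> g" by (rule conj_liftD(2)[OF \<beta> g])
    interpret c: group_hom G G "\<lambda>x. g \<otimes>\<^bsub>G\<^esub> x \<otimes>\<^bsub>G\<^esub> inv\<^bsub>G\<^esub> g"
      by (rule group_hom_conj[OF \<rho>.H.is_group gG])
    show "group_hom E E (\<gamma> g)"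
      unfolding \<gamma>_def
      by (rule lift_hom[OF group_hom_comp[OF \<beta>g.group_hom_axioms base_hom]])
        (use m(1)[OF g] rel[OF g] in \<open>auto simp: \<alpha>\<close>)
    fix e assume "e \<in> carrier E"
    then obtain x i where e: "e = (x, i)" "x \<in> carrier B" by auto
    have "\<theta> (m g, 1) = g \<otimes>\<^bsub>G\<^esub> t \<otimes>\<^bsub>G\<^esub> inv\<^bsub>G\<^esub> g"
      using m[OF g] gG tG by (simp add: \<theta>_def \<rho>.H.m_assoc)
    then have "\<theta> ((m g, 1) [^]\<^bsub>E\<^esub> i) = g \<otimes>\<^bsub>G\<^esub> t [^]\<^bsub>G\<^esub> i \<otimes>\<^bsub>G\<^esub> inv\<^bsub>G\<^esub> g"
      using m(1)[OF g] c.hom_int_pow[OF tG, of i] by (simp add: \<theta>.hom_int_pow)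
    moreover have "\<theta> (\<beta> g x, 0) = g \<otimes>\<^bsub>G\<^esub> \<rho> x \<otimes>\<^bsub>G\<^esub> inv\<^bsub>G\<^esub> g"
      using e(2) conj_liftD(3)[OF \<beta> g e(2)] gG by (simp add: \<theta>_def)
    ultimately have "\<theta> (\<gamma> g e) = g \<otimes>\<^bsub>G\<^esub> \<rho> x \<otimes>\<^bsub>G\<^esub> inv\<^bsub>G\<^esub> g \<otimes>\<^bsub>G\<^esub> (g \<otimes>\<^bsub>G\<^esub> t [^]\<^bsub>G\<^esub> i \<otimes>\<^bsub>G\<^esub> inv\<^bsub>G\<^esub> g)"
      using e \<theta>.hom_mult[of "(\<beta> g x, 0)" "(m g, 1) [^]\<^bsub>E\<^esub> i"] m(1)[OF g]
        E.int_pow_closed[of "(m g, 1)" i] by (simp add: \<gamma>_def del: E_simps(2))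
    also have "\<dots> = g \<otimes>\<^bsub>G\<^esub> (\<rho> x \<otimes>\<^bsub>G\<^esub> t [^]\<^bsub>G\<^esub> i) \<otimes>\<^bsub>G\<^esub> inv\<^bsub>G\<^esub> g"
      using c.hom_mult[of "\<rho> x" "t [^]\<^bsub>G\<^esub> i"] e(2) tG by simp
    finally show "\<theta> (\<gamma> g e) = g \<otimes>\<^bsub>G\<^esub> \<theta> e \<otimes>\<^bsub>G\<^esub> inv\<^bsub>G\<^esub> g"
      using e by (simp add: \<theta>_def)
  qed
  let ?A = "insert (\<one>\<^bsub>B\<^esub>, 1 :: int) ((\<lambda>x. (x, 0)) ` A)"
  have genE: "generate E ?A = carrier E" by (rule E_generated[OF A(2)])
  have AE: "?A \<subseteq> carrier E" unfolding genE[symmetric] by (auto intro: generate.incl)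
  have im\<theta>: "\<theta> ` carrier E = N" unfolding N(2) \<theta>_def by force
  have "fg_op_normal E S \<gamma> (kernel E G \<theta>)"
    by (rule op_presented_transfer[OF N(1) S(1) \<gamma> im\<theta> _ genE]) (use A(1) in auto)
  then obtain W where W: "finite W" "W \<subseteq> kernel E G \<theta>"
    "\<And>D. op_normal E S \<gamma> D \<Longrightarrow> W \<subseteq> D \<Longrightarrow> kernel E G \<theta> \<subseteq> D"
    unfolding fg_op_normal_def by blast
  have "subgroup (\<rho> ` carrier B) G" by (rule \<rho>.img_is_subgroup)
  then obtain n :: int where n: "\<And>i :: int. t [^]\<^bsub>G\<^esub> i \<in> \<rho> ` carrier B \<longleftrightarrow> n dvd i"
    using \<rho>.H.exponents_into_subgroup tG by metis
  obtain h where h: "h \<in> carrier B" "\<rho> h = t [^]\<^bsub>G\<^esub> n" "n = 0 \<Longrightarrow> h = \<one>\<^bsub>B\<^esub>"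
  proof (cases "n = 0")
    case True
    then show ?thesis using that[of "\<one>\<^bsub>B\<^esub>"] by simp
  next
    case False
    have "t [^]\<^bsub>G\<^esub> n \<in> \<rho> ` carrier B" by (simp add: n)
    then show ?thesis using that False by (metis imageE)
  qed
  \<comment> \<open>The element \<open>h\<^sup>-\<^sup>1 t\<^sup>n\<close>; the choice of \<open>h\<close> makes it trivial if \<open>n = 0\<close>, so that no nontrivial
    power of \<open>c\<close> ever lies in the base group.\<close>
  define c where "c = (inv\<^bsub>B\<^esub> h, n)"
  have cE: "c \<in> carrier E" using h(1) by (simp add: c_def)
  have c\<theta>: "\<theta> c = \<one>\<^bsub>G\<^esub>" using h(1,2) tG by (simp add: c_def \<theta>_def)
  have c1: "c = \<one>\<^bsub>E\<^esub>" if "n = 0" using h(3)[OF that] that by (simp add: c_def)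
  have snd_c: "snd (inv\<^bsub>E\<^esub> (c [^]\<^bsub>E\<^esub> k)) = - (k * n)" for k :: int
    using snd_inv[OF E.int_pow_closed[OF cE, of k]] snd_pow[OF cE, of k] by (simp add: c_def)
  define u where "u e = e \<otimes>\<^bsub>E\<^esub> inv\<^bsub>E\<^esub> (c [^]\<^bsub>E\<^esub> (snd e div n))" for e
  have u: "u e = (fst (u e), 0) \<and> fst (u e) \<in> kernel B G \<rho>" if "e \<in> kernel E G \<theta>" for e
  proof -
    note ker = that
    obtain x i where e: "e = (x, i)" "x \<in> carrier B" "\<rho> x \<otimes>\<^bsub>G\<^esub> t [^]\<^bsub>G\<^esub> i = \<one>\<^bsub>G\<^esub>"
      using ker by (cases e) (auto simp: kernel_def \<theta>_def)
    then have "t [^]\<^bsub>G\<^esub> i = \<rho> (inv\<^bsub>B\<^esub> x)"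
      using tG by (metis \<rho>.H.inv_equality \<rho>.H.inv_inv \<rho>.H.int_pow_closed \<rho>.hom_closed \<rho>.hom_inv)
    then have "t [^]\<^bsub>G\<^esub> i \<in> \<rho> ` carrier B" using e(2) by (simp del: \<rho>.hom_inv)
    then have "n dvd i" by (simp add: n)
    then have "snd (u e) = 0"
      using e by (simp add: u_def snd_mult snd_c)
    moreover have uE: "u e \<in> carrier E" 
      unfolding u_def using ker
      by (intro E.m_closed E.inv_closed E.int_pow_closed cE) (simp add: kernel_def del: E_simps)
    moreover have "\<theta> (u e) = \<one>\<^bsub>G\<^esub>"
      using that cE c\<theta> unfolding u_def by (simp add: kernel_def \<theta>.hom_int_pow del: E_simps)
    ultimately show ?thesis by (cases "u e") (auto simp: \<theta>_def kernel_def)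
  qed
  have u0: "u (x, 0) = (x, 0)" if "x \<in> carrier B" for x
    using that by (simp add: u_def)
  \<comment> \<open>The last two sets consist of elements \<open>(x, 0)\<close>: they lie in the base group because the integers
    are abelian and the operators fix the exponent of \<open>t\<close>.\<close>
  define V where "V = W \<union> (\<lambda>a. c \<otimes>\<^bsub>E\<^esub> a \<otimes>\<^bsub>E\<^esub> inv\<^bsub>E\<^esub> (a \<otimes>\<^bsub>E\<^esub> c)) ` ?A
    \<union> (\<lambda>g. \<gamma> g c \<otimes>\<^bsub>E\<^esub> inv\<^bsub>E\<^esub> c) ` S"
  have "finite V" using W(1) A(1) S(1) by (simp add: V_def)
  have Vker: "V \<subseteq> kernel E G \<theta>"
  proof -
    have "c \<otimes>\<^bsub>E\<^esub> a \<otimes>\<^bsub>E\<^esub> inv\<^bsub>E\<^esub> (a \<otimes>\<^bsub>E\<^esub> c) \<in> kernel E G \<theta>" if "a \<in> ?A" for a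
    proof -
      have "a \<in> carrier E" using that AE by blast
      then show ?thesis using cE c\<theta> by (simp add: kernel_def del: E_simps)
    qed
    moreover have "\<gamma> g c \<otimes>\<^bsub>E\<^esub> inv\<^bsub>E\<^esub> c \<in> kernel E G \<theta>" if "g \<in> S" for g
    proof -
      have "\<gamma> g c \<in> carrier E" using conj_liftD(2)[OF \<gamma> that] cE by (rule group_hom.hom_closed)
      moreover have "\<theta> (\<gamma> g c) = \<one>\<^bsub>G\<^esub>"
        using conj_liftD(3)[OF \<gamma> that cE] c\<theta> that S by auto
      ultimately show ?thesis using cE c\<theta> by (simp add: kernel_def del: E_simps)
    qed
    ultimately show ?thesis using W(2) unfolding V_def by blast
  qed
  have "kernel B G \<rho> \<subseteq> P" if P: "op_normal B S \<beta> P" and VP: "(\<lambda>e. fst (u e)) ` V \<subseteq> P" for P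
  proof
    fix x assume x: "x \<in> kernel B G \<rho>"
    note mult_FactGroup [simp del] one_FactGroup [simp del]
    have "P \<times> {0} \<lhd> E"
      using P S(3,4) by (intro base_normal) (auto simp: op_normal_def \<alpha>)
    then interpret P0: normal "P \<times> {0}" E .
    interpret Q: group "E Mod (P \<times> {0})" by (rule P0.factorgroup_is_group)
    define q where "q e = (P \<times> {0}) #>\<^bsub>E\<^esub> e" for e
    have q: "group_hom E (E Mod (P \<times> {0})) q"
      unfolding q_def by (rule group_homI[OF group_E Q.is_group P0.r_coset_hom_Mod])
    interpret q: group_hom E "E Mod (P \<times> {0})" q by (rule q)
    let ?Q = "E Mod (P \<times> {0})"
    have q_eq: "q e = q e' \<longleftrightarrow> e \<otimes>\<^bsub>E\<^esub> inv\<^bsub>E\<^esub> e' \<in> P \<times> {0}" if "e \<in> carrier E" "e' \<in> carrier E" for e e'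
      unfolding q_def using that by (rule P0.rcos_eq_iff)
    have q_surj: "q ` carrier E = carrier ?Q" by (simp add: carrier_FactGroup q_def)
    have uP: "u e \<in> P \<times> {0}" if "e \<in> V" for e
      using u[of e] that Vker VP by (metis (no_types, lifting) SigmaI image_subset_iff singletonI subsetD)
    have VP0: "e \<in> P \<times> {0}" if "e \<in> V" "snd e = 0" for e
      using uP[OF that(1)] u0[of "fst e"] that Vker by (cases e) (auto simp: kernel_def)
    have comm: "q c \<otimes>\<^bsub>?Q\<^esub> y = y \<otimes>\<^bsub>?Q\<^esub> q c" if "y \<in> carrier ?Q" for y
    proof -
      have "y \<in> q ` carrier E" using that q_surj by blast
      then obtain e where e: "e \<in> carrier E" "y = q e" by blast
      have "q c \<otimes>\<^bsub>?Q\<^esub> q e \<otimes>\<^bsub>?Q\<^esub> inv\<^bsub>?Q\<^esub> q c = q e"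
      proof (rule group_hom_eq_on_generators[OF _ q genE _ e(1)])
        show "group_hom E ?Q (\<lambda>e. q c \<otimes>\<^bsub>?Q\<^esub> q e \<otimes>\<^bsub>?Q\<^esub> inv\<^bsub>?Q\<^esub> q c)"
          by (rule group_hom_comp[OF q group_hom_conj[OF Q.is_group]]) (use cE q.hom_closed in blast)
        fix a assume a: "a \<in> ?A"
        then have aE: "a \<in> carrier E" using AE by blast
        have "c \<otimes>\<^bsub>E\<^esub> a \<otimes>\<^bsub>E\<^esub> inv\<^bsub>E\<^esub> (a \<otimes>\<^bsub>E\<^esub> c) \<in> V" using a unfolding V_def by blast
        moreover have "snd (c \<otimes>\<^bsub>E\<^esub> a \<otimes>\<^bsub>E\<^esub> inv\<^bsub>E\<^esub> (a \<otimes>\<^bsub>E\<^esub> c)) = 0"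
          using aE cE E.m_closed[OF aE cE] by (simp add: snd_mult snd_inv)
        ultimately have "q (c \<otimes>\<^bsub>E\<^esub> a) = q (a \<otimes>\<^bsub>E\<^esub> c)"
          using aE cE by (subst q_eq) (auto intro: VP0 simp del: E_simps)
        then show "q c \<otimes>\<^bsub>?Q\<^esub> q a \<otimes>\<^bsub>?Q\<^esub> inv\<^bsub>?Q\<^esub> q c = q a"
          using aE cE by (simp add: Q.m_assoc del: E_simps)
      qed
      then show ?thesis
        using e cE by (metis Q.inv_solve_right q.hom_closed Q.m_closed)
    qed
    \<comment> \<open>Modulo \<open>P\<close> the element \<open>c\<close> is central, so its powers form a normal subgroup \<open>C\<close>.  The preimage \<open>D\<close> of
      \<open>C\<close> in \<open>E\<close> is the product of \<open>P\<close> and \<open>\<langle>c\<rangle>\<close>, which meets the base group in \<open>P\<close>.\<close>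
    define C where "C = {y. \<exists>k :: int. y = q c [^]\<^bsub>?Q\<^esub> k}"
    have qc: "q c \<in> carrier ?Q" using cE by (rule q.hom_closed)
    have "C \<lhd> ?Q"
      unfolding Q.normal_inv_iff
    proof (intro conjI ballI)
      have "C = generate ?Q {q c}" using Q.generate_pow[OF qc] by (auto simp: C_def)
      then show "subgroup C ?Q" using Q.generate_is_subgroup[of "{q c}"] qc by simp
      fix y z assume y: "y \<in> carrier ?Q" and "z \<in> C"
      then obtain k :: int where z: "z = q c [^]\<^bsub>?Q\<^esub> k" by (auto simp: C_def)
      interpret cy: group_hom ?Q ?Q "\<lambda>z. y \<otimes>\<^bsub>?Q\<^esub> z \<otimes>\<^bsub>?Q\<^esub> inv\<^bsub>?Q\<^esub> y"
        by (rule group_hom_conj[OF Q.is_group y])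
      have "y \<otimes>\<^bsub>?Q\<^esub> q c \<otimes>\<^bsub>?Q\<^esub> inv\<^bsub>?Q\<^esub> y = q c"
        using comm[OF y] y qc by (metis Q.inv_solve_right Q.m_closed)
      then have "y \<otimes>\<^bsub>?Q\<^esub> z \<otimes>\<^bsub>?Q\<^esub> inv\<^bsub>?Q\<^esub> y = z"
        using cy.hom_int_pow[OF qc, of k] z by simp
      then show "y \<otimes>\<^bsub>?Q\<^esub> z \<otimes>\<^bsub>?Q\<^esub> inv\<^bsub>?Q\<^esub> y \<in> C" using \<open>z \<in> C\<close> by simp
    qed
    define D where "D = {e \<in> carrier E. q e \<in> C}"
    have D_iff: "e \<in> D \<longleftrightarrow> (\<exists>k :: int. e \<otimes>\<^bsub>E\<^esub> inv\<^bsub>E\<^esub> (c [^]\<^bsub>E\<^esub> k) \<in> P \<times> {0})" if "e \<in> carrier E" for e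
      using that cE by (simp add: D_def C_def q_eq[symmetric] q.hom_int_pow del: E_simps)
    have "op_normal E S \<gamma> D"
      unfolding op_normal_def
    proof (intro conjI ballI)
      show "D \<lhd> E" unfolding D_def by (rule normal_vimage[OF q \<open>C \<lhd> ?Q\<close>])
      fix g assume g: "g \<in> S"
      interpret \<gamma>g: group_hom E E "\<gamma> g" by (rule conj_liftD(2)[OF \<gamma> g])
      have "\<gamma> g c \<otimes>\<^bsub>E\<^esub> inv\<^bsub>E\<^esub> c \<in> P \<times> {0}"
      proof (rule VP0)
        show "\<gamma> g c \<otimes>\<^bsub>E\<^esub> inv\<^bsub>E\<^esub> c \<in> V" using g by (simp add: V_def)
        have "(m g, 1) \<in> carrier E" using m(1)[OF g] by simp
        then have "snd (\<gamma> g c) = snd c" by (simp add: \<gamma>_def c_def snd_mult snd_pow)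
        then show "snd (\<gamma> g c \<otimes>\<^bsub>E\<^esub> inv\<^bsub>E\<^esub> c) = 0" using cE by (simp add: snd_mult snd_inv)
      qed
      then have \<gamma>c: "q (\<gamma> g c) = q c" using cE by (subst q_eq) (auto simp del: E_simps)
      show "\<gamma> g ` D \<subseteq> D"
      proof (rule image_subsetI)
        fix e assume "e \<in> D"
        then have e: "e \<in> carrier E" by (simp add: D_def)
        then obtain k :: int where k: "e \<otimes>\<^bsub>E\<^esub> inv\<^bsub>E\<^esub> (c [^]\<^bsub>E\<^esub> k) \<in> P \<times> {0}"
          using D_iff[OF e] \<open>e \<in> D\<close> by metis
        have "\<gamma> g p \<in> P \<times> {0}" if "p \<in> P \<times> {0}" for p
          using that P g P0.mem_carrier[OF that] conj_liftD(2)[OF \<beta> g, THEN group_hom.hom_closed]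
          by (auto simp: \<gamma>_def op_normal_def image_subset_iff)
        from this[OF k] have "q (\<gamma> g e) = q (\<gamma> g c [^]\<^bsub>E\<^esub> k)"
          using e cE by (subst q_eq) (auto simp: \<gamma>g.hom_int_pow simp del: E_simps)
        also have "\<dots> = q c [^]\<^bsub>?Q\<^esub> k"
          using cE \<gamma>c by (simp add: q.hom_int_pow del: E_simps)
        finally have "q (\<gamma> g e) \<in> C" by (auto simp: C_def)
        then show "\<gamma> g e \<in> D" using e \<gamma>g.hom_closed by (simp add: D_def del: E_simps)
      qed
    qed
    moreover have "W \<subseteq> D"
    proof
      fix w assume w: "w \<in> W"
      then have "w \<in> V" by (simp add: V_def)
      from uP[OF this, unfolded u_def] show "w \<in> D"
        using D_iff[of w] w W(2) by (metis (no_types, lifting) kernel_def mem_Collect_eq subsetD)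
    qed
    ultimately have "kernel E G \<theta> \<subseteq> D" by (rule W(3))
    moreover have "(x, 0) \<in> kernel E G \<theta>"
      using x by (simp add: kernel_def \<theta>_def)
    ultimately have xD: "(x, 0) \<in> D" by blast
    have "(x, 0) \<in> carrier E" using x by (simp add: kernel_def)
    from D_iff[OF this] xD obtain k :: int where k: "(x, 0) \<otimes>\<^bsub>E\<^esub> inv\<^bsub>E\<^esub> (c [^]\<^bsub>E\<^esub> k) \<in> P \<times> {0}"
      by metis
    then have "snd ((x, 0 :: int) \<otimes>\<^bsub>E\<^esub> inv\<^bsub>E\<^esub> (c [^]\<^bsub>E\<^esub> k)) = 0" by (metis mem_Times_iff singletonD)
    then have "k * n = 0"
      by (simp add: snd_mult snd_c)
    then have "c [^]\<^bsub>E\<^esub> k = \<one>\<^bsub>E\<^esub>" using c1 by (auto simp del: E_simps)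
    then show "x \<in> P" using k x by (simp add: kernel_def)
  qed
  moreover have "(\<lambda>e. fst (u e)) ` V \<subseteq> kernel B G \<rho>" using u Vker by blast
  ultimately show ?thesis
    unfolding fg_op_normal_def using \<open>finite V\<close> by (intro exI[of _ "(\<lambda>e. fst (u e)) ` V"]) simp
qed

text \<open>
  The hypothesis on commutators says that \<open>S\<close> acts trivially on the cyclic quotient, so
  conjugation by \<open>g\<close> sends \<open>t\<close> to \<open>m\<^sub>g t\<close> with \<open>m\<^sub>g \<in> M\<close>.
\<close>

lemma op_presented_descend:
  assumes N: "op_presented G S N" "N = {x \<otimes>\<^bsub>G\<^esub> t [^]\<^bsub>G\<^esub> (i :: int) | x i. x \<in> M}"
    and M: "M \<lhd> G" "finite A" "generate G A = M" "A \<subseteq> carrier G"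
    and S: "finite S" "S \<subseteq> carrier G" "t \<in> S" "inv\<^bsub>G\<^esub> t \<in> S"
    and comm: "\<And>g. g \<in> S \<Longrightarrow> g \<otimes>\<^bsub>G\<^esub> t \<otimes>\<^bsub>G\<^esub> inv\<^bsub>G\<^esub> g \<otimes>\<^bsub>G\<^esub> inv\<^bsub>G\<^esub> t \<in> M"
  shows "op_presented G S M"
proof -
  interpret M: normal M G by (rule M)
  have tG: "t \<in> carrier G" using S by auto
  obtain Z :: "nat set" and \<rho> where Z: "finite Z" and \<rho>: "group_hom (free_group Z) G \<rho>"
    and im\<rho>: "\<rho> ` carrier (free_group Z) = M"
    using free_group_onto[OF M.is_group M(2,4)] M(3) by metis
  let ?F = "free_group Z"
  let ?z = "\<lambda>z :: nat. [(z, True)]"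
  interpret \<rho>: group_hom ?F G \<rho> by (rule \<rho>)
  obtain \<phi> where \<phi>: "conj_lift G S ?F \<rho> \<phi>"
    using free_group_conj_lift[OF \<rho> _ S(2)] im\<rho> M(1) by metis
  have \<phi>_hom: "group_hom ?F ?F (\<phi> g)" if "g \<in> S" for g
    by (rule conj_liftD(2)[OF \<phi> that])
  have \<phi>_closed: "\<phi> g w \<in> carrier ?F" if "g \<in> S" "w \<in> carrier ?F" for g w
    using \<phi>_hom[OF that(1)] that(2) by (rule group_hom.hom_closed)
  have "\<exists>w\<in>carrier ?F. \<rho> w = g \<otimes>\<^bsub>G\<^esub> t \<otimes>\<^bsub>G\<^esub> inv\<^bsub>G\<^esub> g \<otimes>\<^bsub>G\<^esub> inv\<^bsub>G\<^esub> t" if "g \<in> S" for g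
    using comm[OF that] unfolding im\<rho>[symmetric] by force
  then obtain m where m: "\<And>g. g \<in> S \<Longrightarrow> m g \<in> carrier ?F"
    "\<And>g. g \<in> S \<Longrightarrow> \<rho> (m g) = g \<otimes>\<^bsub>G\<^esub> t \<otimes>\<^bsub>G\<^esub> inv\<^bsub>G\<^esub> g \<otimes>\<^bsub>G\<^esub> inv\<^bsub>G\<^esub> t"
    by metis
  have zF: "?z z \<in> carrier ?F" if "z \<in> Z" for z
    using that by (auto simp: carrier_free_group reduced_def)
  let ?t' = "inv\<^bsub>G\<^esub> t"
  \<comment> \<open>Relators needed for the semidirect product and its operators to exist: the lifts for \<open>t\<close> and its
    inverse are mutually inverse, and \<open>\<phi>\<^sub>g\<close> respects \<open>t x t\<^sup>-\<^sup>1 = \<phi>\<^sub>t(x)\<close> when \<open>t\<close> is sent to \<open>m\<^sub>g t\<close>.\<close>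
  define R where "R = (\<lambda>z. \<phi> t (\<phi> ?t' (?z z)) \<otimes>\<^bsub>?F\<^esub> inv\<^bsub>?F\<^esub> (?z z)) ` Z
    \<union> (\<lambda>z. \<phi> ?t' (\<phi> t (?z z)) \<otimes>\<^bsub>?F\<^esub> inv\<^bsub>?F\<^esub> (?z z)) ` Z
    \<union> (\<lambda>(g, z). m g \<otimes>\<^bsub>?F\<^esub> \<phi> t (\<phi> g (?z z)) \<otimes>\<^bsub>?F\<^esub> inv\<^bsub>?F\<^esub> (m g) \<otimes>\<^bsub>?F\<^esub>
        inv\<^bsub>?F\<^esub> (\<phi> g (\<phi> t (?z z)))) ` (S \<times> Z)"
  have "finite R" unfolding R_def using Z S(1) by auto
  have Rker: "R \<subseteq> kernel ?F G \<rho>"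
  proof -
    have "\<phi> t (\<phi> ?t' (?z z)) \<otimes>\<^bsub>?F\<^esub> inv\<^bsub>?F\<^esub> (?z z) \<in> kernel ?F G \<rho>"
      "\<phi> ?t' (\<phi> t (?z z)) \<otimes>\<^bsub>?F\<^esub> inv\<^bsub>?F\<^esub> (?z z) \<in> kernel ?F G \<rho>" if "z \<in> Z" for z
      using zF[OF that] S(3,4) tG
      by (simp_all add: kernel_def \<phi>_closed conj_liftD(3)[OF \<phi>] M.m_assoc M.inv_solve_left')
    moreover have "m g \<otimes>\<^bsub>?F\<^esub> \<phi> t (\<phi> g (?z z)) \<otimes>\<^bsub>?F\<^esub> inv\<^bsub>?F\<^esub> (m g) \<otimes>\<^bsub>?F\<^esub>
        inv\<^bsub>?F\<^esub> (\<phi> g (\<phi> t (?z z))) \<in> kernel ?F G \<rho>" if g: "g \<in> S" and z: "z \<in> Z" for g z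
    proof -
      have gG: "g \<in> carrier G" using S g by auto
      show ?thesis
        using zF[OF z] S(3) g gG tG m[OF g]
        by (simp add: kernel_def \<phi>_closed conj_liftD(3)[OF \<phi>] M.m_assoc M.inv_mult_group M.inv_mult_cancel)
    qed
    ultimately show ?thesis unfolding R_def by auto
  qed
  have kn: "op_normal ?F S \<phi> (kernel ?F G \<rho>)" by (rule op_normal_kernel[OF \<phi> S(2)])
  have "R \<subseteq> carrier ?F" using Rker by (auto simp: kernel_def)
  then obtain L where L: "op_normal ?F S \<phi> L" "R \<subseteq> L"
    and Lmin: "\<And>D. op_normal ?F S \<phi> D \<Longrightarrow> R \<subseteq> D \<Longrightarrow> L \<subseteq> D"
    using op_normal_closure[of ?F S \<phi> R, OF group_free_group \<phi>_hom] by blast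
  have Lker: "L \<subseteq> kernel ?F G \<rho>" by (rule Lmin[OF kn Rker])
  have Ln: "L \<lhd> ?F" using L(1) by (simp add: op_normal_def)
  interpret L: normal L ?F by (rule Ln)
  define B where "B = ?F Mod L"
  define q where "q w = L #>\<^bsub>?F\<^esub> w" for w
  interpret B: group B unfolding B_def by (rule L.factorgroup_is_group)
  have q: "group_hom ?F B q"
    using group_homI[OF group_free_group B.is_group] L.r_coset_hom_Mod
    unfolding q_def B_def by blast
  interpret q: group_hom ?F B q by (rule q)
  have q_surj: "q ` carrier ?F = carrier B" by (simp add: carrier_FactGroup q_def B_def)
  have q_eq: "q w = q w' \<longleftrightarrow> w \<otimes>\<^bsub>?F\<^esub> inv\<^bsub>?F\<^esub> w' \<in> L" if "w \<in> carrier ?F" "w' \<in> carrier ?F" for w w'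
    unfolding q_def using that by (rule L.rcos_eq_iff)
  have ker_q: "kernel ?F B q = L"
  proof -
    have "q w = q \<one>\<^bsub>?F\<^esub> \<longleftrightarrow> w \<in> L" if "w \<in> carrier ?F" for w
      using that by (subst q_eq) auto
    then show ?thesis using L.subset by (auto simp: kernel_def)
  qed
  obtain \<rho>' where \<rho>': "group_hom B G \<rho>'" and \<rho>'q: "\<And>w. w \<in> carrier ?F \<Longrightarrow> \<rho>' (q w) = \<rho> w"
    using group_hom_factor[OF Ln \<rho> Lker] unfolding B_def q_def by blast
  have "\<exists>b. group_hom B B b \<and> (\<forall>w\<in>carrier ?F. b (q w) = q (\<phi> g w))" if g: "g \<in> S" for g
  proof -
    have k: "L \<subseteq> kernel ?F B (\<lambda>w. q (\<phi> g w))"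
    proof
      fix w assume w: "w \<in> L"
      then have "\<phi> g w \<in> kernel ?F B q" using L(1) g unfolding ker_q op_normal_def by blast
      then show "w \<in> kernel ?F B (\<lambda>w. q (\<phi> g w))" using w by (simp add: kernel_def)
    qed
    obtain b where "group_hom (?F Mod L) B b"
      "\<And>w. w \<in> carrier ?F \<Longrightarrow> b (L #>\<^bsub>?F\<^esub> w) = q (\<phi> g w)"
      using group_hom_factor[OF Ln group_hom_comp[OF \<phi>_hom[OF g] q] k] by metis
    then show ?thesis unfolding B_def[symmetric] q_def[symmetric] by blast
  qed
  then obtain \<beta> where \<beta>hom: "\<And>g. g \<in> S \<Longrightarrow> group_hom B B (\<beta> g)"
    and \<beta>q: "\<And>g w. g \<in> S \<Longrightarrow> w \<in> carrier ?F \<Longrightarrow> \<beta> g (q w) = q (\<phi> g w)"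
    by metis
  interpret \<rho>': group_hom B G \<rho>' by (rule \<rho>')
  have \<beta>: "conj_lift G S B \<rho>' \<beta>"
    unfolding conj_lift_def
  proof (intro conjI ballI \<rho>' \<beta>hom)
    fix g b assume g: "g \<in> S" and "b \<in> carrier B"
    then obtain w where w: "w \<in> carrier ?F" "b = q w" using q_surj by blast
    then show "\<rho>' (\<beta> g b) = g \<otimes>\<^bsub>G\<^esub> \<rho>' b \<otimes>\<^bsub>G\<^esub> inv\<^bsub>G\<^esub> g"
      using g by (simp add: \<beta>q \<rho>'q \<phi>_closed conj_liftD(3)[OF \<phi>])
  qed
  let ?A = "q ` ?z ` Z"
  have zs: "?z ` Z \<subseteq> carrier ?F" using zF by auto
  have genB: "generate B ?A = carrier B"
    using q.generate_img[OF zs] q_surj by (simp add: free_group_generated)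
  have inv1: "\<beta> t (\<beta> ?t' x) = x" if "x \<in> carrier B" for x
  proof (rule group_hom_eq_on_generators[OF _ _ genB _ that])
    show "group_hom B B (\<lambda>x. \<beta> t (\<beta> ?t' x))" by (rule group_hom_comp[OF \<beta>hom \<beta>hom]) (use S in auto)
    show "group_hom B B (\<lambda>x. x)" by (intro group_homI homI B.is_group) auto
    fix a assume "a \<in> ?A"
    then obtain z where z: "z \<in> Z" "a = q (?z z)" by auto
    have "\<phi> t (\<phi> ?t' (?z z)) \<otimes>\<^bsub>?F\<^esub> inv\<^bsub>?F\<^esub> (?z z) \<in> L" using z L(2) unfolding R_def by blast
    then show "\<beta> t (\<beta> ?t' a) = a"
      using z(2) zF[OF z(1)] S(3,4) q_eq by (simp add: \<beta>q \<phi>_closed)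
  qed
  have inv2: "\<beta> ?t' (\<beta> t x) = x" if "x \<in> carrier B" for x
  proof (rule group_hom_eq_on_generators[OF _ _ genB _ that])
    show "group_hom B B (\<lambda>x. \<beta> ?t' (\<beta> t x))" by (rule group_hom_comp[OF \<beta>hom \<beta>hom]) (use S in auto)
    show "group_hom B B (\<lambda>x. x)" by (intro group_homI homI B.is_group) auto
    fix a assume "a \<in> ?A"
    then obtain z where z: "z \<in> Z" "a = q (?z z)" by auto
    have "\<phi> ?t' (\<phi> t (?z z)) \<otimes>\<^bsub>?F\<^esub> inv\<^bsub>?F\<^esub> (?z z) \<in> L" using z L(2) unfolding R_def by blast
    then show "\<beta> ?t' (\<beta> t a) = a"
      using z(2) zF[OF z(1)] S(3,4) q_eq by (simp add: \<beta>q \<phi>_closed)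
  qed
  have rel: "q (m g) \<otimes>\<^bsub>B\<^esub> \<beta> t (\<beta> g x) = \<beta> g (\<beta> t x) \<otimes>\<^bsub>B\<^esub> q (m g)"
    if g: "g \<in> S" and x: "x \<in> carrier B" for g x
  proof -
    have mB: "q (m g) \<in> carrier B" using m(1)[OF g] by simp
    have "q (m g) \<otimes>\<^bsub>B\<^esub> \<beta> t (\<beta> g x) \<otimes>\<^bsub>B\<^esub> inv\<^bsub>B\<^esub> q (m g) = \<beta> g (\<beta> t x)"
    proof (rule group_hom_eq_on_generators[OF _ _ genB _ x])
      show "group_hom B B (\<lambda>x. q (m g) \<otimes>\<^bsub>B\<^esub> \<beta> t (\<beta> g x) \<otimes>\<^bsub>B\<^esub> inv\<^bsub>B\<^esub> q (m g))"
        by (rule group_hom_comp[OF group_hom_comp[OF \<beta>hom \<beta>hom] group_hom_conj[OF B.is_group mB]])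
          (use S g in auto)
      show "group_hom B B (\<lambda>x. \<beta> g (\<beta> t x))" by (rule group_hom_comp[OF \<beta>hom \<beta>hom]) (use S g in auto)
      fix a assume "a \<in> ?A"
      then obtain z where z: "z \<in> Z" "a = q (?z z)" by auto
      have "m g \<otimes>\<^bsub>?F\<^esub> \<phi> t (\<phi> g (?z z)) \<otimes>\<^bsub>?F\<^esub> inv\<^bsub>?F\<^esub> (m g) \<otimes>\<^bsub>?F\<^esub>
        inv\<^bsub>?F\<^esub> (\<phi> g (\<phi> t (?z z))) \<in> L" using g z L(2) unfolding R_def by blast
      then have "q (m g \<otimes>\<^bsub>?F\<^esub> \<phi> t (\<phi> g (?z z)) \<otimes>\<^bsub>?F\<^esub> inv\<^bsub>?F\<^esub> (m g)) = q (\<phi> g (\<phi> t (?z z)))"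
        using zF[OF z(1)] S(3) g m(1)[OF g] by (subst q_eq) (auto simp: \<phi>_closed)
      then show "q (m g) \<otimes>\<^bsub>B\<^esub> \<beta> t (\<beta> g a) \<otimes>\<^bsub>B\<^esub> inv\<^bsub>B\<^esub> q (m g) = \<beta> g (\<beta> t a)"
        using z(2) zF[OF z(1)] S(3) g m(1)[OF g] by (simp add: \<beta>q \<phi>_closed)
    qed
    moreover have "\<beta> t (\<beta> g x) \<in> carrier B" "\<beta> g (\<beta> t x) \<in> carrier B"
      using \<beta>hom g S(3) x group_hom.hom_closed by metis+
    ultimately show ?thesis using mB by (metis B.inv_solve_right B.m_closed)
  qed
  obtain \<alpha> where \<alpha>: "int_action B \<alpha>" "\<alpha> 1 = \<beta> t" "\<alpha> (- 1) = \<beta> ?t'"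
    using int_action_of_inverses[OF \<beta>hom[OF S(3)] \<beta>hom[OF S(4)] inv1 inv2] by metis
  have fgB: "fg_op_normal B S \<beta> (kernel B G \<rho>')"
  proof (rule fg_op_normal_descend[OF \<alpha>(1) \<beta> S \<alpha>(2,3) _ _ rel _ genB N(1)])
    show "q (m g) \<in> carrier B" "\<rho>' (q (m g)) = g \<otimes>\<^bsub>G\<^esub> t \<otimes>\<^bsub>G\<^esub> inv\<^bsub>G\<^esub> g \<otimes>\<^bsub>G\<^esub> inv\<^bsub>G\<^esub> t" if "g \<in> S" for g
      using m[OF that] by (simp_all add: \<rho>'q)
    show "finite ?A" using Z by auto
    have "M = \<rho>' ` carrier B"
      unfolding im\<rho>[symmetric] q_surj[symmetric] image_image by (intro image_cong) (auto simp: \<rho>'q)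
    then show "N = {\<rho>' x \<otimes>\<^bsub>G\<^esub> t [^]\<^bsub>G\<^esub> (i :: int) | x i. x \<in> carrier B}"
      unfolding N(2) by blast
  qed
  have qker: "q ` kernel ?F G \<rho> = kernel B G \<rho>'"
    by (auto simp: kernel_def \<rho>'q q_surj[symmetric] image_iff)
  have fgL: "fg_op_normal ?F S \<phi> L"
    unfolding fg_op_normal_def using \<open>finite R\<close> L(2) Lmin by blast
  have "fg_op_normal ?F S \<phi> (kernel ?F G \<rho>)"
  proof (rule fg_op_normal_tower[OF q q_surj])
    show "q (\<phi> g w) = \<beta> g (q w)" if "g \<in> S" "w \<in> carrier ?F" for g w
      using \<beta>q[OF that] by simp
    show "kernel ?F G \<rho> \<subseteq> carrier ?F" by (auto simp: kernel_def)
  qed (simp_all only: ker_q qker fgB fgL Lker)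
  then show ?thesis
    unfolding op_presented_def using Z \<phi> im\<rho> by blast
qed

section \<open>Finitely generated normal subgroups with abelian quotient\<close>

theorem theoremD:
  fixes G :: "('a, 'b) monoid_scheme" and H :: "'a set" and l :: nat
  assumes "finitely_presented G"
    and "H \<lhd> G"
    and "finitely_generated (G\<lparr>carrier := H\<rparr>)"
    and "comm_group (G Mod H)"
    and "has_torsion_free_rank (G Mod H) l"
    and "l \<le> 2"
  shows "invariantly_finitely_L_presented (G\<lparr>carrier := H\<rparr>)"
proof -
  interpret H: normal H G by fact
  note comm = commutators_in_normal[OF assms(2,4)]
  obtain T where T: "finite T" "T \<subseteq> carrier G" "generate G T = carrier G"
    using op_presented_finitely_generated[OF finitely_presented_imp_op_presented[OF assms(1), of "{}"]]
    by auto
  define S where "S = T \<union> (\<lambda>t. inv\<^bsub>G\<^esub> t) ` T"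
  have S: "finite S" "S \<subseteq> carrier G" using T by (auto simp: S_def)
  obtain Y where Y: "finite Y" "Y \<subseteq> H" "generate G Y = H"
    using assms(3) H.generate_consistent[OF _ H.subgroup_axioms] unfolding finitely_generated_def by auto
  \<comment> \<open>Removing the generators of \<open>G\<close> one at a time leaves the chain of subgroups from \<open>G\<close> down to \<open>H\<close>.\<close>
  have "op_presented G S (generate G (A \<union> Y)) \<Longrightarrow> op_presented G S H" if "finite A" "A \<subseteq> T" for A
    using that
  proof (induction A rule: finite_induct)
    case empty
    then show ?case using Y(3) by simp
  next
    case (insert t A)
    have t: "t \<in> carrier G" "t \<in> S" "inv\<^bsub>G\<^esub> t \<in> S" using insert.prems(2) T by (auto simp: S_def)
    have AY: "A \<union> Y \<subseteq> carrier G" using insert.prems(2) T(2) Y(2) H.subset by blast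
    have "subgroup (generate G (A \<union> Y)) G" by (rule H.generate_is_subgroup[OF AY])
    moreover have HM: "H \<subseteq> generate G (A \<union> Y)"
      unfolding Y(3)[symmetric] by (rule H.mono_generate) auto
    ultimately have M: "generate G (A \<union> Y) \<lhd> G"
      using comm by (intro normal_if_commutators H.is_group) auto
    have "op_presented G S (generate G (A \<union> Y))"
    proof (rule op_presented_descend[OF insert.prems(1) _ M _ refl AY S t(2,3)])
      show "generate G (insert t A \<union> Y) =
          {x \<otimes>\<^bsub>G\<^esub> t [^]\<^bsub>G\<^esub> (i :: int) | x i. x \<in> generate G (A \<union> Y)}"
        using generate_insert_normal[OF M refl AY t(1)] by simp
      show "finite (A \<union> Y)" using insert.hyps(1) Y(1) by simp
      show "g \<otimes>\<^bsub>G\<^esub> t \<otimes>\<^bsub>G\<^esub> inv\<^bsub>G\<^esub> g \<otimes>\<^bsub>G\<^esub> inv\<^bsub>G\<^esub> t \<in> generate G (A \<union> Y)" if "g \<in> S" for g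
        using comm[of g t] that S(2) t(1) HM by blast
    qed
    then show ?case using insert.IH insert.prems(2) by simp
  qed
  moreover have "generate G (T \<union> Y) = carrier G"
  proof
    show "generate G (T \<union> Y) \<subseteq> carrier G"
      using T(2) Y(2) H.subset by (intro H.generate_incl) auto
    show "carrier G \<subseteq> generate G (T \<union> Y)"
      unfolding T(3)[symmetric] by (rule H.mono_generate) auto
  qed
  ultimately have "op_presented G S H"
    using T(1) finitely_presented_imp_op_presented[OF assms(1) S(2)] by simp
  then show ?thesis
    by (rule op_presented_imp_L_presented[OF _ S H.subgroup_axioms])
qed

end
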